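(* Let $\lambda\in\mathbb R$ and let $\vec v\in\mathbb R^3$ be a unit vector. There are no closed $\lambda$-translating solitons with density vector $\vec v$; that is, there is no immersion $\psi:\Sigma\to\mathbb R^3$ of a closed (compact without boundary) orientable surface $\Sigma$ whose mean curvature $H$ satisfies $2H=2\lambda+\langle N,\vec v\rangle$ on $\Sigma$, where $N$ is the Gauss map.
   Context: Surfaces and immersions are smooth. $2H$ denotes the sum of the principal curvatures with respect to $N$, with the sign for which $\Delta\langle\psi,\vec a\rangle=2H\langle N,\vec a\rangle$ for every $\vec a\in\mathbb R^3$, $\Delta$ being the Laplacian of the induced metric. *)

theory Defs
  imports "HOL-Analysis.Analysis"
begin

text \<open>
  \<open>C_k_on k f S\<close> is meant for open \<open>S\<close>; since all directions are Euclidean vectors, continuity of the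
  iterated directional derivatives up to order \<open>k\<close> is the usual \<open>C\<^sup>k\<close> condition.
\<close>

primrec C_k_on :: "nat \<Rightarrow> ('b::euclidean_space \<Rightarrow> 'c::euclidean_space) \<Rightarrow> 'b set \<Rightarrow> bool" where
  "C_k_on 0 f S \<longleftrightarrow> continuous_on S f"
| "C_k_on (Suc k) f S \<longleftrightarrow> (\<forall>x\<in>S. f differentiable (at x)) \<and>
     (\<forall>w. C_k_on k (\<lambda>x. frechet_derivative f (at x) w) S)"

definition smooth_on :: "('b::euclidean_space \<Rightarrow> 'c::euclidean_space) \<Rightarrow> 'b set \<Rightarrow> bool" where
  "smooth_on f S \<longleftrightarrow> (\<forall>k. C_k_on k f S)"

text \<open>
  A chart is a pair \<open>(U, \<phi>)\<close>; the values of \<open>\<phi>\<close> off \<open>U\<close> are irrelevant. A surface is a topology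
  together with a (not necessarily maximal) smooth atlas. Charts map onto open subsets of the plane,
  so surfaces have no boundary.
\<close>

type_synonym 'a chart = "'a set \<times> ('a \<Rightarrow> real^2)"

definition chart_inv :: "'a chart \<Rightarrow> real^2 \<Rightarrow> 'a" where
  "chart_inv c = inv_into (fst c) (snd c)"

definition is_chart :: "'a topology \<Rightarrow> 'a chart \<Rightarrow> bool" where
  "is_chart X c \<longleftrightarrow> openin X (fst c) \<and> open (snd c ` fst c) \<and>
     homeomorphic_map (subtopology X (fst c)) (top_of_set (snd c ` fst c)) (snd c)"

definition smooth_atlas :: "'a topology \<Rightarrow> 'a chart set \<Rightarrow> bool" where
  "smooth_atlas X A \<longleftrightarrow>
     (\<forall>c\<in>A. is_chart X c) \<and> (\<Union>c\<in>A. fst c) = topspace X \<and>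
     (\<forall>c\<in>A. \<forall>d\<in>A. smooth_on (snd d \<circ> chart_inv c) (snd c ` (fst c \<inter> fst d)))"

definition smooth_surface :: "'a topology \<Rightarrow> 'a chart set \<Rightarrow> bool" where
  "smooth_surface X A \<longleftrightarrow>
     topspace X \<noteq> {} \<and> Hausdorff_space X \<and> second_countable X \<and> smooth_atlas X A"

definition closed_surface :: "'a topology \<Rightarrow> 'a chart set \<Rightarrow> bool" where
  "closed_surface X A \<longleftrightarrow> smooth_surface X A \<and> compact_space X"

definition orientable_surface :: "'a topology \<Rightarrow> 'a chart set \<Rightarrow> bool" where
  "orientable_surface X A \<longleftrightarrow> smooth_surface X A \<and>
     (\<exists>B. smooth_atlas X B \<and> smooth_atlas X (A \<union> B) \<and>
       (\<forall>c\<in>B. \<forall>d\<in>B. \<forall>p \<in> fst c \<inter> fst d.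
          det (matrix (frechet_derivative (snd d \<circ> chart_inv c) (at (snd c p)))) > 0))"

definition smooth_map :: "'a chart set \<Rightarrow> ('a \<Rightarrow> 'c::euclidean_space) \<Rightarrow> bool" where
  "smooth_map A F \<longleftrightarrow> (\<forall>c\<in>A. smooth_on (F \<circ> chart_inv c) (snd c ` fst c))"

text \<open>The differential of \<open>F\<close> at \<open>p\<close>, the tangent plane at \<open>p\<close> being identified with the plane by the
  chart \<open>c\<close>.\<close>

definition chart_diff :: "'a chart \<Rightarrow> ('a \<Rightarrow> 'c::euclidean_space) \<Rightarrow> 'a \<Rightarrow> real^2 \<Rightarrow> 'c" where
  "chart_diff c F p = frechet_derivative (F \<circ> chart_inv c) (at (snd c p))"

definition immersion :: "'a chart set \<Rightarrow> ('a \<Rightarrow> real^3) \<Rightarrow> bool" where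
  "immersion A \<psi> \<longleftrightarrow> smooth_map A \<psi> \<and> (\<forall>c\<in>A. \<forall>p\<in>fst c. inj (chart_diff c \<psi> p))"

text \<open>A Gauss map is any smooth unit normal field, i.e. one for either choice of orientation.\<close>

definition gauss_map :: "'a chart set \<Rightarrow> ('a \<Rightarrow> real^3) \<Rightarrow> ('a \<Rightarrow> real^3) \<Rightarrow> bool" where
  "gauss_map A \<psi> N \<longleftrightarrow> smooth_map A N \<and>
     (\<forall>c\<in>A. \<forall>p\<in>fst c. norm (N p) = 1 \<and> (\<forall>w. N p \<bullet> chart_diff c \<psi> p w = 0))"

text \<open>
  \<open>\<kappa>\<^sub>1\<close>, \<open>\<kappa>\<^sub>2\<close> are the eigenvalues, with multiplicity, of the shape operator \<open>-dN\<close>: it is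
  self-adjoint for the induced metric, so there is an orthonormal basis of principal directions
  \<open>e\<^sub>1\<close>, \<open>e\<^sub>2\<close>. Since \<open>D\<^sup>2\<psi>(v,w) \<bullet> N = -(dN v \<bullet> d\<psi> w)\<close>, the trace of this operator is
  \<open>\<Delta>\<psi> \<bullet> N\<close>, so that \<open>\<Delta>(\<psi> \<bullet> a) = (\<kappa>\<^sub>1 + \<kappa>\<^sub>2) (N \<bullet> a)\<close>; the unit sphere with outward normal has
  \<open>\<kappa>\<^sub>1 = \<kappa>\<^sub>2 = -1\<close>. The condition does not depend on the chart \<open>c\<close>.
\<close>

definition principal_curvatures ::
  "'a chart set \<Rightarrow> ('a \<Rightarrow> real^3) \<Rightarrow> ('a \<Rightarrow> real^3) \<Rightarrow> 'a \<Rightarrow> real \<Rightarrow> real \<Rightarrow> bool" where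
  "principal_curvatures A \<psi> N p \<kappa>\<^sub>1 \<kappa>\<^sub>2 \<longleftrightarrow>
     (\<exists>c\<in>A. p \<in> fst c \<and> (\<exists>e\<^sub>1 e\<^sub>2.
        norm (chart_diff c \<psi> p e\<^sub>1) = 1 \<and> norm (chart_diff c \<psi> p e\<^sub>2) = 1 \<and>
        chart_diff c \<psi> p e\<^sub>1 \<bullet> chart_diff c \<psi> p e\<^sub>2 = 0 \<and>
        - chart_diff c N p e\<^sub>1 = \<kappa>\<^sub>1 *\<^sub>R chart_diff c \<psi> p e\<^sub>1 \<and>
        - chart_diff c N p e\<^sub>2 = \<kappa>\<^sub>2 *\<^sub>R chart_diff c \<psi> p e\<^sub>2))"

definition mean_curvature ::
  "'a chart set \<Rightarrow> ('a \<Rightarrow> real^3) \<Rightarrow> ('a \<Rightarrow> real^3) \<Rightarrow> 'a \<Rightarrow> real" where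
  "mean_curvature A \<psi> N p =
     (THE H. \<exists>\<kappa>\<^sub>1 \<kappa>\<^sub>2. principal_curvatures A \<psi> N p \<kappa>\<^sub>1 \<kappa>\<^sub>2 \<and> 2 * H = \<kappa>\<^sub>1 + \<kappa>\<^sub>2)"

definition translating_soliton ::
  "real \<Rightarrow> real^3 \<Rightarrow> 'a topology \<Rightarrow> 'a chart set \<Rightarrow> ('a \<Rightarrow> real^3) \<Rightarrow> ('a \<Rightarrow> real^3) \<Rightarrow> bool" where
  "translating_soliton l v X A \<psi> N \<longleftrightarrow>
     orientable_surface X A \<and> immersion A \<psi> \<and> gauss_map A \<psi> N \<and>
     (\<forall>p\<in>topspace X. 2 * mean_curvature A \<psi> N p = 2 * l + N p \<bullet> v)"

end

theory Submission
  imports Defs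
begin

text \<open>
  On a \<open>\<lambda>\<close>-translating soliton the height \<open>\<langle>\<psi>, v\<rangle>\<close> satisfies
  \<open>\<Delta>\<langle>\<psi>, v\<rangle> = 2 H \<langle>N, v\<rangle> = 2 \<lambda> \<langle>N, v\<rangle> + \<langle>N, v\<rangle>\<^sup>2\<close>. On a closed surface both \<open>\<Delta>\<langle>\<psi>, v\<rangle>\<close> and
  \<open>\<langle>N, v\<rangle>\<close> integrate to zero, the latter because \<open>\<langle>N, v\<rangle> dA\<close> is the exterior derivative of
  \<open>\<langle>v, \<psi> \<times> d\<psi>\<rangle> / 2\<close>. So \<open>\<langle>N, v\<rangle>\<^sup>2\<close> integrates to zero and \<open>\<langle>N, v\<rangle>\<close> vanishes identically.
  This is absurd at a highest point in the direction \<open>v\<close>, where \<open>N = v\<close> or \<open>N = - v\<close>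
  (lemma \<open>normal_at_highest_point\<close>). The maximum principle for the height alone would not suffice:
  at its extrema the equation gives a contradiction only for small \<open>\<bar>\<lambda>\<bar>\<close>.

  Both integral identities are combined into one application of Stokes' theorem. The 1-form
  \<open>\<langle>Z, d\<psi>\<rangle>\<close> with \<open>Z = (N + \<lambda> \<psi>) \<times> v\<close> satisfies \<open>d\<langle>Z, d\<psi>\<rangle> = \<langle>N, v\<rangle>\<^sup>2 dA\<close>
  (lemma \<open>scalar_curl_soliton\<close>). The left side involves first derivatives of \<open>N\<close> and
  \<open>\<psi>\<close> alone, and the one curvature fact behind it is that \<open>2 H\<close> is the trace of \<open>- dN\<close>, in the form
  \<open>dN u \<times> d\<psi> w + d\<psi> u \<times> dN w = - 2 H d\<psi> u \<times> d\<psi> w\<close> (lemma \<open>trace_form_mean_curvature\<close>). It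
  rests on the existence of principal directions, hence on the symmetry of the shape operator, hence on
  the symmetry of second derivatives (theorem \<open>second_derivative_symmetric\<close>).

  Stokes' theorem on the surface (theorem \<open>scalar_curl_nonneg_eq_0\<close>) is obtained from the plane
  (theorem \<open>stokes_compact_support\<close>) by a partition of unity; integrals in different charts are compared
  by the change of variables theorem (lemma \<open>chart_integral_change\<close>). The Gauss map \<open>N\<close> provides the
  orientation.
\<close>

section \<open>Continuously differentiable maps\<close>

lemma C1_iff:
  "C_k_on 1 f S \<longleftrightarrow> (\<forall>x\<in>S. f differentiable (at x)) \<and>
     (\<forall>w. continuous_on S (\<lambda>x. frechet_derivative f (at x) w))"
  by simp

lemma C_k_on_continuous: "C_k_on k f S \<Longrightarrow> continuous_on S f"
  by (cases k) (auto intro!: differentiable_imp_continuous_on differentiable_at_imp_differentiable_on)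

lemma frechet_derivative_cong_open:
  assumes "open S" "x \<in> S" "\<And>y. y \<in> S \<Longrightarrow> f y = g y"
  shows "frechet_derivative f (at x) = frechet_derivative g (at x)"
proof -
  have "(f has_derivative D) (at x) \<longleftrightarrow> (g has_derivative D) (at x)" for D
    using has_derivative_transform_within_open[of f D x UNIV S g]
      has_derivative_transform_within_open[of g D x UNIV S f] assms by auto
  then show ?thesis by (simp add: frechet_derivative_def)
qed

lemma differentiable_cong_open:
  assumes "open S" "x \<in> S" "\<And>y. y \<in> S \<Longrightarrow> f y = g y" "f differentiable (at x)"
  shows "g differentiable (at x)"
  using assms has_derivative_transform_within_open[of f _ x UNIV S g]
  unfolding differentiable_def by auto

lemma C_k_on_cong:
  assumes "open S" "\<And>y. y \<in> S \<Longrightarrow> f y = g y" "C_k_on k f S"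
  shows "C_k_on k g S"
  using assms
proof (induction k arbitrary: f g)
  case 0
  then show ?case by (simp cong: continuous_on_cong)
next
  case (Suc k)
  have "g differentiable (at x)" if "x \<in> S" for x
    using differentiable_cong_open[OF Suc.prems(1) that Suc.prems(2)] Suc.prems(3) that by auto
  moreover have "C_k_on k (\<lambda>x. frechet_derivative g (at x) w) S" for w
  proof (rule Suc.IH[OF Suc.prems(1)])
    show "C_k_on k (\<lambda>x. frechet_derivative f (at x) w) S" using Suc.prems by simp
    show "frechet_derivative f (at y) w = frechet_derivative g (at y) w" if "y \<in> S" for y
      using frechet_derivative_cong_open[OF Suc.prems(1) that Suc.prems(2)] by simp
  qed
  ultimately show ?case by simp
qed

lemma C_k_on_subset: "C_k_on k f S \<Longrightarrow> T \<subseteq> S \<Longrightarrow> C_k_on k f T"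
  by (induction k arbitrary: f) (auto intro: continuous_on_subset)

lemma C1I:
  assumes "\<And>x. x \<in> S \<Longrightarrow> (f has_derivative D x) (at x)"
    and "\<And>w. continuous_on S (\<lambda>x. D x w)"
  shows "C_k_on 1 f S"
proof -
  have "frechet_derivative f (at x) = D x" if "x \<in> S" for x
    using frechet_derivative_at[OF assms(1)[OF that]] by simp
  then show ?thesis using assms unfolding C1_iff
    by (auto simp: differentiable_def cong: continuous_on_cong)
qed

lemma C1_const: "C_k_on 1 (\<lambda>x. c) S"
  by (rule C1I[where D="\<lambda>_ _. 0"]) auto

lemma C1_bilinear:
  assumes B: "bounded_bilinear B" and "C_k_on 1 f S" "C_k_on 1 g S"
  shows "C_k_on 1 (\<lambda>x. B (f x) (g x)) S"
proof (rule C1I)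
  show "((\<lambda>x. B (f x) (g x)) has_derivative
      (\<lambda>w. B (f x) (frechet_derivative g (at x) w) + B (frechet_derivative f (at x) w) (g x))) (at x)"
    if "x \<in> S" for x
    by (rule bounded_bilinear.FDERIV[OF B])
      (use assms that in \<open>auto simp: C1_iff intro: frechet_derivative_works[THEN iffD1]\<close>)
  show "continuous_on S
     (\<lambda>x. B (f x) (frechet_derivative g (at x) w) + B (frechet_derivative f (at x) w) (g x))" for w
    using assms C_k_on_continuous[OF assms(2)] C_k_on_continuous[OF assms(3)]
    by (intro continuous_on_add bounded_bilinear.continuous_on[OF B]) (auto simp: C1_iff)
qed

lemma C1_add:
  assumes "C_k_on 1 f S" "C_k_on 1 g S"
  shows "C_k_on 1 (\<lambda>x. f x + g x) S"
proof (rule C1I)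
  show "((\<lambda>x. f x + g x) has_derivative
      (\<lambda>w. frechet_derivative f (at x) w + frechet_derivative g (at x) w)) (at x)" if "x \<in> S" for x
    using assms that by (intro has_derivative_add) (auto simp: C1_iff intro: frechet_derivative_works[THEN iffD1])
  show "continuous_on S (\<lambda>x. frechet_derivative f (at x) w + frechet_derivative g (at x) w)" for w
    using assms by (intro continuous_on_add) (auto simp: C1_iff)
qed

lemma C1_sum:
  assumes "\<And>i. i \<in> I \<Longrightarrow> C_k_on 1 (f i) S"
  shows "C_k_on 1 (\<lambda>x. \<Sum>i\<in>I. f i x) S"
  using assms
proof (induction I rule: infinite_finite_induct)
  case (insert i I)
  then show ?case using C1_add[of "f i" S "\<lambda>x. \<Sum>i\<in>I. f i x"] by simp
qed (simp_all add: C1_const del: C_k_on.simps One_nat_def)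

lemma C1_inverse:
  fixes f :: "'a::euclidean_space \<Rightarrow> real"
  assumes "C_k_on 1 f S" "\<And>x. x \<in> S \<Longrightarrow> f x \<noteq> 0"
  shows "C_k_on 1 (\<lambda>x. inverse (f x)) S"
proof (rule C1I)
  show "((\<lambda>x. inverse (f x)) has_derivative
      (\<lambda>w. - (inverse (f x) * frechet_derivative f (at x) w * inverse (f x)))) (at x)" if "x \<in> S" for x
    by (rule Deriv.has_derivative_inverse) (use assms that in \<open>auto simp: C1_iff intro: frechet_derivative_works[THEN iffD1]\<close>)
  show "continuous_on S (\<lambda>x. - (inverse (f x) * frechet_derivative f (at x) w * inverse (f x)))" for w
    using assms C_k_on_continuous[OF assms(1)]
    by (intro continuous_intros) (auto simp: C1_iff)
qed

lemma linear_expand_basis: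
  fixes L :: "'a::euclidean_space \<Rightarrow> 'b::real_vector"
  assumes "linear L"
  shows "L w = (\<Sum>b\<in>Basis. (w \<bullet> b) *\<^sub>R L b)"
  by (metis (no_types, lifting) assms euclidean_representation linear_sum linear_scale sum.cong)

lemma C1_compose:
  assumes "C_k_on 1 g T" "C_k_on 1 f S" "f ` S \<subseteq> T"
  shows "C_k_on 1 (\<lambda>x. g (f x)) S"
proof (rule C1I)
  let ?f = "\<lambda>x. frechet_derivative f (at x)" and ?g = "\<lambda>x. frechet_derivative g (at x)"
  have g: "(g has_derivative ?g (f x)) (at (f x))" if "x \<in> S" for x
    using assms that by (auto simp: C1_iff intro: frechet_derivative_works[THEN iffD1])
  have f: "(f has_derivative ?f x) (at x)" if "x \<in> S" for x
    using assms that by (auto simp: C1_iff intro: frechet_derivative_works[THEN iffD1])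
  show "((\<lambda>x. g (f x)) has_derivative (\<lambda>w. ?g (f x) (?f x w))) (at x)" if "x \<in> S" for x
    using has_derivative_compose[OF f[OF that] g[OF that]] .
  have "continuous_on S f" using C_k_on_continuous assms(2) by blast
  then have "continuous_on S (\<lambda>x. ?g (f x) b)" for b
    using assms continuous_on_compose2[of T "\<lambda>x. ?g x b" S f] by (auto simp: C1_iff)
  then have "continuous_on S (\<lambda>x. \<Sum>b\<in>Basis. (?f x w \<bullet> b) *\<^sub>R ?g (f x) b)" for w
    using assms(2) by (intro continuous_intros) (auto simp: C1_iff)
  moreover have "?g (f x) (?f x w) = (\<Sum>b\<in>Basis. (?f x w \<bullet> b) *\<^sub>R ?g (f x) b)" if "x \<in> S" for x w
    by (rule linear_expand_basis) (use has_derivative_linear[OF g[OF that]] in auto)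
  ultimately show "continuous_on S (\<lambda>x. ?g (f x) (?f x w))" for w
    by (simp cong: continuous_on_cong)
qed

lemma C_k_on_Un:
  assumes "open S" "open T" "C_k_on k f S" "C_k_on k f T"
  shows "C_k_on k f (S \<union> T)"
  using assms
  by (induction k arbitrary: f) (auto intro: continuous_on_open_Un)

text \<open>Differentiability across the boundary of \<open>S\<close> is automatic, because the extension vanishes on the
  open set \<open>- K\<close>, which together with \<open>S\<close> covers the space.\<close>

lemma C_k_on_extend_zero:
  assumes "open S" "compact K" "K \<subseteq> S" "C_k_on k f S" "\<And>x. x \<in> S - K \<Longrightarrow> f x = 0"
  shows "C_k_on k (\<lambda>x. if x \<in> S then f x else 0) UNIV"
proof -
  have 0: "C_k_on k (\<lambda>x::'a. 0::'b) T" for T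
    by (induction k) auto
  have "C_k_on k (\<lambda>x. if x \<in> S then f x else 0) S"
    by (rule C_k_on_cong[OF _ _ assms(4)]) (use assms in auto)
  moreover have "C_k_on k (\<lambda>x. if x \<in> S then f x else 0) (- K)"
    by (rule C_k_on_cong[OF _ _ 0]) (use assms in \<open>auto simp: compact_imp_closed open_Compl\<close>)
  moreover have "S \<union> - K = UNIV" using assms by auto
  ultimately show ?thesis
    using C_k_on_Un[of S "-K" k] assms by (simp add: compact_imp_closed open_Compl)
qed

section \<open>Integration by parts in Euclidean space\<close>

lemma has_real_derivative_along_line:
  fixes f :: "'a::euclidean_space \<Rightarrow> real"
  assumes "f differentiable (at (x + t *\<^sub>R u))"
  shows "((\<lambda>t. f (x + t *\<^sub>R u)) has_real_derivative frechet_derivative f (at (x + t *\<^sub>R u)) u) (at t)"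
proof -
  let ?D = "frechet_derivative f (at (x + t *\<^sub>R u))"
  have D: "(f has_derivative ?D) (at (x + t *\<^sub>R u))"
    using assms frechet_derivative_works by blast
  have "((\<lambda>t. x + t *\<^sub>R u) has_derivative (\<lambda>s. s *\<^sub>R u)) (at t)"
    by (auto intro!: derivative_eq_intros)
  from has_derivative_compose[OF this D]
  have "((\<lambda>t. f (x + t *\<^sub>R u)) has_derivative (\<lambda>s. ?D (s *\<^sub>R u))) (at t)" .
  moreover have "?D (s *\<^sub>R u) = ?D u * s" for s
    using linear_scale[OF has_derivative_linear[OF D]] by simp
  ultimately show ?thesis by (simp add: has_field_derivative_def mult_commute_abs)
qed

text \<open>The second difference is the increment of \<open>s \<mapsto> f (x + s u + h w) - f (x + s u)\<close> over \<open>[0, h]\<close>; the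
  mean value theorem is applied first in \<open>s\<close> and then in the direction \<open>w\<close>.\<close>

lemma second_difference_mean_value:
  fixes f :: "'a::euclidean_space \<Rightarrow> real"
  assumes "C_k_on 2 f S" "h > 0"
    and S: "\<And>s t. 0 \<le> s \<Longrightarrow> s \<le> h \<Longrightarrow> 0 \<le> t \<Longrightarrow> t \<le> h \<Longrightarrow> x + s *\<^sub>R u + t *\<^sub>R w \<in> S"
  obtains s t where "0 < s" "s < h" "0 < t" "t < h"
    "f (x + h *\<^sub>R u + h *\<^sub>R w) - f (x + h *\<^sub>R u) - f (x + h *\<^sub>R w) + f x
       = h^2 * frechet_derivative (\<lambda>y. frechet_derivative f (at y) u) (at (x + s *\<^sub>R u + t *\<^sub>R w)) w"
proof -
  let ?fu = "\<lambda>y. frechet_derivative f (at y) u"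
  have f: "f differentiable (at y)" "?fu differentiable (at y)" if "y \<in> S" for y
    using assms(1) that by (auto simp: numeral_2_eq_2)
  have S0: "x + s *\<^sub>R u \<in> S" if "0 \<le> s" "s \<le> h" for s
    using S[of s 0] that assms(2) by simp
  have Sh: "(x + h *\<^sub>R w) + s *\<^sub>R u \<in> S" if "0 \<le> s" "s \<le> h" for s
    using S[of s h] that assms(2) by (simp add: ac_simps)
  have "\<exists>s>0. s < h \<and> (f ((x + h *\<^sub>R w) + h *\<^sub>R u) - f (x + h *\<^sub>R u))
      - (f ((x + h *\<^sub>R w) + 0 *\<^sub>R u) - f (x + 0 *\<^sub>R u)) =
      (h - 0) * (?fu ((x + h *\<^sub>R w) + s *\<^sub>R u) - ?fu (x + s *\<^sub>R u))"
    by (rule MVT2[OF assms(2), where f="\<lambda>s. f ((x + h *\<^sub>R w) + s *\<^sub>R u) - f (x + s *\<^sub>R u)"])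
      (intro DERIV_diff has_real_derivative_along_line f S0 Sh; simp)
  then obtain s where s: "s > 0" "s < h" and eq1: "(f ((x + h *\<^sub>R w) + h *\<^sub>R u) - f (x + h *\<^sub>R u))
      - (f (x + h *\<^sub>R w) - f x) = h * (?fu ((x + h *\<^sub>R w) + s *\<^sub>R u) - ?fu (x + s *\<^sub>R u))"
    by auto
  have "\<exists>t>0. t < h \<and> ?fu ((x + s *\<^sub>R u) + h *\<^sub>R w) - ?fu ((x + s *\<^sub>R u) + 0 *\<^sub>R w)
      = (h - 0) * frechet_derivative ?fu (at ((x + s *\<^sub>R u) + t *\<^sub>R w)) w"
    by (rule MVT2[OF assms(2), where f="\<lambda>t. ?fu ((x + s *\<^sub>R u) + t *\<^sub>R w)"])
      (intro has_real_derivative_along_line f S; use s in simp)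
  then obtain t where t: "t > 0" "t < h" and eq2: "?fu ((x + s *\<^sub>R u) + h *\<^sub>R w) - ?fu (x + s *\<^sub>R u)
      = h * frechet_derivative ?fu (at ((x + s *\<^sub>R u) + t *\<^sub>R w)) w"
    by auto
  have c: "(x + h *\<^sub>R w) + s *\<^sub>R u = (x + s *\<^sub>R u) + h *\<^sub>R w" for s by simp
  show thesis
    by (rule that[OF s t]) (use eq1 eq2 in \<open>simp add: c power2_eq_square algebra_simps\<close>)
qed

text \<open>The second difference does not change when \<open>u\<close> and \<open>w\<close> are exchanged, so both iterated derivatives
  are limits of the same quotient.\<close>

lemma second_derivative_symmetric_real:
  fixes f :: "'a::euclidean_space \<Rightarrow> real"
  assumes "C_k_on 2 f S" "open S" "x \<in> S"
  shows "frechet_derivative (\<lambda>y. frechet_derivative f (at y) u) (at x) w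
       = frechet_derivative (\<lambda>y. frechet_derivative f (at y) w) (at x) u"
proof -
  define G where "G u w y = frechet_derivative (\<lambda>y. frechet_derivative f (at y) u) (at y) w" for u w y
  define Q where "Q h = (f (x + h *\<^sub>R u + h *\<^sub>R w) - f (x + h *\<^sub>R u) - f (x + h *\<^sub>R w) + f x) / h^2" for h
  have G: "isCont (G u w) x" for u w
  proof -
    have "continuous_on S (G u w)"
      using assms(1) unfolding G_def by (simp add: numeral_2_eq_2)
    then show ?thesis using assms(2,3) continuous_on_eq_continuous_at by blast
  qed
  \<comment> \<open>The formula for \<open>Q\<close> is a premise here, so that \<open>lim\<close> can be used with \<open>u\<close> and \<open>w\<close> exchanged.\<close>
  have lim: "(Q \<longlongrightarrow> G u w x) (at_right 0)"
    if Q: "\<And>h. Q h = (f (x + h *\<^sub>R u + h *\<^sub>R w) - f (x + h *\<^sub>R u) - f (x + h *\<^sub>R w) + f x) / h^2" for u w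
  proof (rule tendstoI)
    fix e :: real assume "e > 0"
    then obtain d where d: "d > 0" "\<And>y. dist y x < d \<Longrightarrow> dist (G u w y) (G u w x) < e"
      using G[of u w] unfolding continuous_at_eps_delta by (auto simp: dist_norm)
    obtain r where r: "r > 0" "ball x r \<subseteq> S" using assms openE by blast
    define M where "M = norm u + norm w + 1"
    define k where "k = min d r / M"
    have M: "M > 0" by (simp add: M_def add_nonneg_pos)
    have k: "k > 0" using d r M by (simp add: k_def)
    have near: "dist (x + s *\<^sub>R u + t *\<^sub>R w) x < min d r"
      if "0 \<le> s" "s \<le> h" "0 \<le> t" "t \<le> h" "h < k" for s t h
    proof -
      have "dist (x + s *\<^sub>R u + t *\<^sub>R w) x \<le> s * norm u + t * norm w"
        using norm_triangle_ineq[of "s *\<^sub>R u" "t *\<^sub>R w"] that by (simp add: dist_norm algebra_simps)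
      also have "\<dots> \<le> h * norm u + h * norm w"
        using that by (intro add_mono mult_right_mono) auto
      also have "\<dots> \<le> h * M" using that by (simp add: M_def algebra_simps)
      also have "\<dots> < k * M" using that M by simp
      also have "\<dots> = min d r" using M by (simp add: k_def)
      finally show ?thesis .
    qed
    have "dist (Q h) (G u w x) < e" if h: "0 < h" "h < k" for h
    proof -
      have "x + s *\<^sub>R u + t *\<^sub>R w \<in> S" if "0 \<le> s" "s \<le> h" "0 \<le> t" "t \<le> h" for s t
        using near[OF that h(2)] r(2) by (auto simp: dist_commute)
      then obtain s t where st: "0 < s" "s < h" "0 < t" "t < h"
        and eq: "f (x + h *\<^sub>R u + h *\<^sub>R w) - f (x + h *\<^sub>R u) - f (x + h *\<^sub>R w) + f x
           = h^2 * G u w (x + s *\<^sub>R u + t *\<^sub>R w)"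
        using second_difference_mean_value[OF assms(1) h(1), of x u w] unfolding G_def by blast
      have "Q h = G u w (x + s *\<^sub>R u + t *\<^sub>R w)" using h by (simp add: Q eq)
      then show ?thesis using d(2) near[of s h t] st h by simp
    qed
    then show "\<forall>\<^sub>F h in at_right 0. dist (Q h) (G u w x) < e"
      unfolding eventually_at_right_field using k by blast
  qed
  have "(Q \<longlongrightarrow> G u w x) (at_right 0)" by (rule lim) (simp add: Q_def)
  moreover have "(Q \<longlongrightarrow> G w u x) (at_right 0)"
    by (rule lim) (simp add: Q_def algebra_simps)
  ultimately have "G u w x = G w u x"
    using tendsto_unique trivial_limit_at_right_real by blast
  then show ?thesis by (simp add: G_def)
qed

lemma frechet_derivative_inner_left:
  assumes "f differentiable (at x)"
  shows "frechet_derivative (\<lambda>y. f y \<bullet> b) (at x) w = frechet_derivative f (at x) w \<bullet> b"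
proof -
  have "((\<lambda>y. f y \<bullet> b) has_derivative (\<lambda>w. frechet_derivative f (at x) w \<bullet> b)) (at x)"
    using assms frechet_derivative_works by (intro has_derivative_inner_left) blast
  then show ?thesis using frechet_derivative_at by metis
qed

lemma C_k_on_inner_left:
  assumes "C_k_on k f S" "open S"
  shows "C_k_on k (\<lambda>y. f y \<bullet> b) S"
  using assms(1)
proof (induction k arbitrary: f)
  case 0
  then show ?case by (auto intro: continuous_intros)
next
  case (Suc k)
  have "C_k_on k (\<lambda>x. frechet_derivative (\<lambda>y. f y \<bullet> b) (at x) w) S" for w
    by (rule C_k_on_cong[OF assms(2) _ Suc.IH[of "\<lambda>x. frechet_derivative f (at x) w"]])
      (use Suc.prems in \<open>simp_all add: frechet_derivative_inner_left\<close>)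
  then show ?case using Suc.prems by (auto intro: differentiable_inner)
qed

theorem second_derivative_symmetric:
  fixes f :: "'a::euclidean_space \<Rightarrow> 'b::euclidean_space"
  assumes "C_k_on 2 f S" "open S" "x \<in> S"
  shows "frechet_derivative (\<lambda>y. frechet_derivative f (at y) u) (at x) w
       = frechet_derivative (\<lambda>y. frechet_derivative f (at y) w) (at x) u"
proof (rule euclidean_eqI)
  fix b :: 'b
  have "frechet_derivative (\<lambda>y. frechet_derivative f (at y) u) (at x) w \<bullet> b
      = frechet_derivative (\<lambda>y. frechet_derivative (\<lambda>z. f z \<bullet> b) (at y) u) (at x) w" for u w
  proof -
    have "frechet_derivative (\<lambda>y. frechet_derivative f (at y) u) (at x) w \<bullet> b
        = frechet_derivative (\<lambda>y. frechet_derivative f (at y) u \<bullet> b) (at x) w"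
      by (rule frechet_derivative_inner_left[symmetric]) (use assms in \<open>auto simp: numeral_2_eq_2\<close>)
    also have "\<dots> = frechet_derivative (\<lambda>y. frechet_derivative (\<lambda>z. f z \<bullet> b) (at y) u) (at x) w"
      by (rule fun_cong[OF frechet_derivative_cong_open[OF assms(2,3)]])
        (use assms frechet_derivative_inner_left[of f] in \<open>auto simp: numeral_2_eq_2\<close>)
    finally show ?thesis .
  qed
  then show "frechet_derivative (\<lambda>y. frechet_derivative f (at y) u) (at x) w \<bullet> b
      = frechet_derivative (\<lambda>y. frechet_derivative f (at y) w) (at x) u \<bullet> b"
    using second_derivative_symmetric_real[OF C_k_on_inner_left[OF assms(1,2)] assms(2,3)] by metis
qed

lemma continuous_compact_support_integrable:
  fixes f :: "'a::euclidean_space \<Rightarrow> 'b::euclidean_space"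
  assumes "continuous_on UNIV f" "compact K" "\<And>x. x \<notin> K \<Longrightarrow> f x = 0"
  shows "integrable lborel f"
proof -
  have "integrable lborel (\<lambda>x. indicator K x *\<^sub>R f x)"
    using assms by (intro borel_integrable_compact) (auto intro: continuous_on_subset)
  moreover have "indicator K x *\<^sub>R f x = f x" for x
    using assms(3) by (auto simp: indicator_def)
  ultimately show ?thesis by simp
qed

lemma lborel_integral_translate:
  fixes f :: "'a::euclidean_space \<Rightarrow> real"
  assumes "f \<in> borel_measurable borel"
  shows "(\<integral>x. f (x + a) \<partial>lborel) = (\<integral>x. f x \<partial>lborel)"
proof -
  have "(\<integral>x. f x \<partial>lborel) = (\<integral>x. f x \<partial>distr lborel borel ((+) a))"
    by (simp add: lborel_distr_plus)
  also have "\<dots> = (\<integral>x. f (a + x) \<partial>lborel)"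
    by (rule integral_distr) (use assms in auto)
  finally show ?thesis by (simp add: add.commute)
qed

lemma frechet_derivative_zero_open:
  assumes "open S" "x \<in> S" "\<And>y. y \<in> S \<Longrightarrow> f y = 0"
  shows "frechet_derivative f (at x) w = 0"
  using frechet_derivative_cong_open[of S x f "\<lambda>_. 0"] assms
    by (simp add: frechet_derivative_const)

text \<open>By translation invariance of Lebesgue measure the difference quotients of \<open>f\<close> integrate to zero,
  and they converge to the derivative with a common integrable bound.\<close>

lemma integral_directional_derivative_eq_0:
  fixes f :: "'a::euclidean_space \<Rightarrow> real"
  assumes C1: "C_k_on 1 f UNIV" and K: "compact K" and supp: "\<And>x. x \<notin> K \<Longrightarrow> f x = 0"
  shows "integrable lborel (\<lambda>x. frechet_derivative f (at x) u)"
    and "(\<integral>x. frechet_derivative f (at x) u \<partial>lborel) = 0"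
proof -
  let ?D = "\<lambda>x. frechet_derivative f (at x) u"
  have D0: "?D x = 0" if "x \<notin> K" for x
    by (rule frechet_derivative_zero_open[of "-K"]) (use supp K that in \<open>auto simp: compact_imp_closed open_Compl\<close>)
  have contD: "continuous_on UNIV ?D" and contf: "continuous_on UNIV f"
    using C1 C_k_on_continuous[OF C1] by (auto simp: C1_iff)
  show int: "integrable lborel ?D"
    by (rule continuous_compact_support_integrable[OF contD K D0])
  obtain B where B: "\<And>x. x \<in> K \<Longrightarrow> \<bar>?D x\<bar> \<le> B"
    using compact_imp_bounded[OF compact_continuous_image[OF continuous_on_subset[OF contD] K]]
    unfolding bounded_iff by (metis imageI real_norm_def subset_UNIV)
  \<comment> \<open>If \<open>K\<close> is empty, \<open>B\<close> may be negative.\<close>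
  have B: "\<bar>?D x\<bar> \<le> \<bar>B\<bar>" for x using B[of x] D0[of x] by (cases "x \<in> K") auto
  define t where "t n = inverse (real (Suc n))" for n
  have t: "0 < t n" "t n \<le> 1" for n by (auto simp: t_def field_simps)
  define q where "q n x = (f (x + t n *\<^sub>R u) - f x) / t n" for n x
  \<comment> \<open>\<open>K'\<close> contains the supports of all the difference quotients \<open>q n\<close>.\<close>
  define K' where "K' = (\<lambda>(x,s). x - s *\<^sub>R u) ` (K \<times> {0..1::real})"
  have K': "compact K'" unfolding K'_def
    by (intro compact_continuous_image compact_Times K compact_Icc)
      (auto simp: case_prod_beta intro!: continuous_intros)
  have out: "x + s *\<^sub>R u \<notin> K" if "x \<notin> K'" "0 \<le> s" "s \<le> 1" for x s
  proof
    assume "x + s *\<^sub>R u \<in> K"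
    have "(\<lambda>(x,s). x - s *\<^sub>R u) (x + s *\<^sub>R u, s) \<in> K'"
      unfolding K'_def by (rule imageI) (use \<open>x + s *\<^sub>R u \<in> K\<close> that in simp)
    then show False using that by simp
  qed
  have bound: "\<bar>q n x\<bar> \<le> indicator K' x * \<bar>B\<bar>" for n x
  proof (cases "x \<in> K'")
    case True
    have "\<exists>s>0. s < t n \<and> f (x + t n *\<^sub>R u) - f (x + 0 *\<^sub>R u) = (t n - 0) * ?D (x + s *\<^sub>R u)"
      by (rule MVT2[OF t(1), where f="\<lambda>s. f (x + s *\<^sub>R u)"])
        (intro has_real_derivative_along_line; use C1 in auto)
    then obtain s where "f (x + t n *\<^sub>R u) - f x = t n * ?D (x + s *\<^sub>R u)" by auto
    then have "q n x = ?D (x + s *\<^sub>R u)" using t[of n] by (simp add: q_def)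
    then show ?thesis using B True by simp
  next
    case False
    have "f (x + t n *\<^sub>R u) = 0" "f x = 0"
      using supp out[OF False, of "t n"] out[OF False, of 0] t[of n] by (auto simp: less_imp_le)
    then show ?thesis using False by (simp add: q_def)
  qed
  have conv: "(\<lambda>n. q n x) \<longlonglongrightarrow> ?D x" for x
  proof -
    have "((\<lambda>s. f (x + s *\<^sub>R u)) has_real_derivative ?D (x + 0 *\<^sub>R u)) (at 0)"
      by (rule has_real_derivative_along_line) (use C1 in auto)
    then have "((\<lambda>h. (f (x + h *\<^sub>R u) - f x) / h) \<longlongrightarrow> ?D x) (at 0)"
      by (simp add: DERIV_def)
    moreover have "filterlim t (at 0) sequentially"
      unfolding filterlim_at using t(1) LIMSEQ_inverse_real_of_nat by (auto simp: t_def[abs_def])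
    ultimately show ?thesis unfolding q_def by (rule filterlim_compose)
  qed
  have meas: "f \<in> borel_measurable borel" using contf borel_measurable_continuous_onI by blast
  have intf: "integrable lborel f"
    by (rule continuous_compact_support_integrable[OF contf K supp])
  have intft: "integrable lborel (\<lambda>x. f (x + t n *\<^sub>R u))" for n
    by (rule continuous_compact_support_integrable[OF _ K'])
      (use out t supp in \<open>auto intro!: continuous_intros continuous_on_compose2[OF contf] simp: less_imp_le\<close>)
  have "(\<lambda>n. \<integral>x. q n x \<partial>lborel) \<longlonglongrightarrow> (\<integral>x. ?D x \<partial>lborel)"
  proof (rule integral_dominated_convergence[where w="\<lambda>x. indicator K' x * \<bar>B\<bar>"])
    show "integrable lborel (\<lambda>x. indicator K' x * \<bar>B\<bar>)"
      using borel_integrable_compact[OF K', of "\<lambda>_. \<bar>B\<bar>"] by simp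
    show "q n \<in> borel_measurable lborel" for n
      unfolding q_def using meas by measurable
  qed (use bound conv int in auto)
  moreover have "(\<integral>x. q n x \<partial>lborel) = 0" for n
    unfolding q_def using lborel_integral_translate[OF meas] intf intft[of n] by simp
  ultimately show "(\<integral>x. ?D x \<partial>lborel) = 0"
    by (simp add: LIMSEQ_const_iff)
qed

lemma C_k_on_2D: "C_k_on 2 f S \<Longrightarrow> C_k_on 1 (\<lambda>x. frechet_derivative f (at x) w) S"
  by (simp add: numeral_2_eq_2)

text \<open>The integrand is the value of \<open>d(F \<bullet> dG)\<close> at \<open>(u, w)\<close>, because the second derivatives of \<open>G\<close> are
  symmetric, and \<open>F \<bullet> dG\<close> has compact support.\<close>

theorem stokes_compact_support:
  fixes F G :: "'a::euclidean_space \<Rightarrow> 'b::euclidean_space"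
  assumes S: "open S" and F: "C_k_on 1 F S" and G: "C_k_on 2 G S"
    and K: "compact K" "K \<subseteq> S" and supp: "\<And>x. x \<in> S - K \<Longrightarrow> F x = 0"
  shows "integral S (\<lambda>x. frechet_derivative F (at x) u \<bullet> frechet_derivative G (at x) w
                       - frechet_derivative F (at x) w \<bullet> frechet_derivative G (at x) u) = 0"
proof -
  let ?F = "\<lambda>w x. frechet_derivative F (at x) w" and ?G = "\<lambda>w x. frechet_derivative G (at x) w"
  define P where "P w x = F x \<bullet> ?G w x" for w x
  define E where "E w x = (if x \<in> S then P w x else 0)" for w x
  have P: "C_k_on 1 (P w) S" for w
    unfolding P_def by (rule C1_bilinear[OF bounded_bilinear_inner F C_k_on_2D[OF G]])
  have E: "C_k_on 1 (E w) UNIV" for w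
    unfolding E_def by (rule C_k_on_extend_zero[OF S K P]) (use supp in \<open>auto simp: P_def\<close>)
  have E0: "E w x = 0" if "x \<notin> K" for w x
    using supp that by (auto simp: E_def P_def)
  have dP: "frechet_derivative (E w) (at x) u = F x \<bullet> frechet_derivative (?G w) (at x) u + ?F u x \<bullet> ?G w x"
    if "x \<in> S" for x u w
  proof -
    have "((P w) has_derivative (\<lambda>u. F x \<bullet> frechet_derivative (?G w) (at x) u + ?F u x \<bullet> ?G w x)) (at x)"
      unfolding P_def
      by (rule bounded_bilinear.FDERIV[OF bounded_bilinear_inner])
        (use F C_k_on_2D[OF G] that in \<open>auto intro: frechet_derivative_works[THEN iffD1]\<close>)
    from frechet_derivative_at[OF this] show ?thesis
      using frechet_derivative_cong_open[OF S that, of "E w" "P w"] by (simp add: E_def fun_eq_iff)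
  qed
  let ?J = "\<lambda>x. frechet_derivative (E w) (at x) u - frechet_derivative (E u) (at x) w"
  have J: "?J x = ?F u x \<bullet> ?G w x - ?F w x \<bullet> ?G u x" if "x \<in> S" for x
    using second_derivative_symmetric[OF G S that, of u w] by (simp add: dP[OF that])
  have J0: "?J x = 0" if "x \<notin> S" for x
  proof -
    have "x \<in> - K" "open (- K)" using that K by (auto simp: compact_imp_closed open_Compl)
    then have "frechet_derivative (E w) (at x) u = 0" for w u
      using frechet_derivative_zero_open[of "- K" x "E w"] E0 by simp
    then show ?thesis by simp
  qed
  note I = integral_directional_derivative_eq_0[OF E K(1) E0]
  have "integral S (\<lambda>x. ?F u x \<bullet> ?G w x - ?F w x \<bullet> ?G u x) = integral S ?J"
    by (rule Henstock_Kurzweil_Integration.integral_cong) (simp add: J)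
  also have "\<dots> = integral UNIV (\<lambda>x. if x \<in> S then ?J x else 0)"
    by (simp only: integral_restrict_UNIV)
  also have "\<dots> = integral UNIV ?J"
    by (rule Henstock_Kurzweil_Integration.integral_cong) (use J0 in auto)
  also have "\<dots> = (\<integral>x. ?J x \<partial>lborel)"
    by (intro integral_lborel Bochner_Integration.integrable_diff I)
  also have "\<dots> = 0" using I by simp
  finally show ?thesis .
qed

section \<open>Charts\<close>

lemma chart_inj: "is_chart X c \<Longrightarrow> inj_on (snd c) (fst c)"
  using homeomorphic_imp_injective_map openin_subset unfolding is_chart_def
  by (metis inf.absorb2 topspace_subtopology)

lemma chart_inv_left: "is_chart X c \<Longrightarrow> p \<in> fst c \<Longrightarrow> chart_inv c (snd c p) = p"
  unfolding chart_inv_def using chart_inj by (rule inv_into_f_f)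

lemma chart_inv_right:
  assumes "x \<in> snd c ` fst c"
  shows "snd c (chart_inv c x) = x" "chart_inv c x \<in> fst c"
  using assms unfolding chart_inv_def by (auto intro: f_inv_into_f inv_into_into)

lemma chart_topspace: "is_chart X c \<Longrightarrow> topspace (subtopology X (fst c)) = fst c"
  unfolding is_chart_def using openin_subset by fastforce

lemma chart_image_open:
  assumes "is_chart X c" "openin X V"
  shows "open (snd c ` (fst c \<inter> V))"
proof -
  have "open_map (subtopology X (fst c)) (top_of_set (snd c ` fst c)) (snd c)"
    using assms homeomorphic_imp_open_map unfolding is_chart_def by blast
  moreover have "openin (subtopology X (fst c)) (fst c \<inter> V)"
    using assms(2) by (auto simp: openin_subtopology)
  ultimately have "openin (top_of_set (snd c ` fst c)) (snd c ` (fst c \<inter> V))"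
    unfolding open_map_def by blast
  then show ?thesis using assms(1) openin_open_eq unfolding is_chart_def by blast
qed

lemma chart_compact_image_iff:
  assumes "is_chart X c" "K \<subseteq> fst c"
  shows "compact (snd c ` K) \<longleftrightarrow> compactin X K"
proof -
  have "compactin (top_of_set (snd c ` fst c)) (snd c ` K) \<longleftrightarrow> compactin (subtopology X (fst c)) K"
    by (rule homeomorphic_map_compactness)
      (use assms in \<open>simp_all add: chart_topspace[OF assms(1)] is_chart_def del: topspace_subtopology\<close>)
  then show ?thesis using assms(2) by (auto simp: compactin_subtopology)
qed

lemma chart_preimage_open:
  assumes "is_chart X c" "open B"
  shows "openin X {p \<in> fst c. snd c p \<in> B}"
proof -
  have "continuous_map (subtopology X (fst c)) (top_of_set (snd c ` fst c)) (snd c)"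
    using assms homeomorphic_imp_continuous_map unfolding is_chart_def by blast
  then have "continuous_map (subtopology X (fst c)) euclidean (snd c)"
    using continuous_map_into_fulltopology by blast
  from openin_continuous_map_preimage[OF this, of B]
  have "openin (subtopology X (fst c)) {p \<in> fst c. snd c p \<in> B}"
    using assms(2) by (simp add: chart_topspace[OF assms(1)] del: topspace_subtopology)
  then show ?thesis using assms(1) openin_trans_full unfolding is_chart_def by blast
qed

section \<open>Alternating forms and cross products\<close>

text \<open>This is how the coefficient of a 2-form changes from chart to chart.\<close>

lemma det_transforms_alternating:
  fixes B :: "real^2 \<Rightarrow> real^2 \<Rightarrow> 'v::real_vector"
  assumes B: "bilinear B" "\<And>x. B x x = 0" and T: "linear T"
  shows "B (T (axis 1 1)) (T (axis 2 1)) = det (matrix T) *\<^sub>R B (axis 1 1) (axis 2 1)"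
proof -
  have anti: "B x y = - B y x" for x y
  proof -
    have "B (x + y) (x + y) = B x x + B y x + (B x y + B y y)"
      by (simp only: bilinear_ladd[OF B(1)] bilinear_radd[OF B(1)])
    then have "B x y + B y x = 0" by (simp add: B(2) add.commute)
    then show ?thesis by (simp add: eq_neg_iff_add_eq_0)
  qed
  have ex: "x = (x $ 1) *\<^sub>R axis 1 1 + (x $ 2) *\<^sub>R axis 2 1" for x :: "real^2"
    by (simp add: vec_eq_iff forall_2 axis_def)
  have "B (a *\<^sub>R axis 1 1 + b *\<^sub>R axis 2 1) (c *\<^sub>R axis 1 1 + d *\<^sub>R axis 2 1)
      = (a * d - b * c) *\<^sub>R B (axis 1 1) (axis 2 1)" for a b c d
    using anti[of "axis 2 1" "axis 1 1"]
    by (simp add: bilinear_ladd[OF B(1)] bilinear_radd[OF B(1)] bilinear_lmul[OF B(1)]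
        bilinear_rmul[OF B(1)] B(2) scaleR_diff_left mult.commute)
  then show ?thesis
    using ex[of "T (axis 1 1)"] ex[of "T (axis 2 1)"]
    by (simp add: det_2 matrix_def) (metis mult.commute)
qed

lemma normal_cross:
  fixes n a b :: "real^3"
  assumes "norm n = 1" "n \<bullet> a = 0" "n \<bullet> b = 0"
  shows "cross3 a b = (n \<bullet> cross3 a b) *\<^sub>R n"
proof -
  have "cross3 n (cross3 a b) = 0"
    using assms by (simp add: Lagrange)
  then have "cross3 n (cross3 n (cross3 a b)) = 0" by simp
  then show ?thesis using assms Lagrange[of n n "cross3 a b"] by (simp add: norm_eq_1)
qed

lemma cross_nonzero_of_inj:
  fixes L :: "real^2 \<Rightarrow> real^3"
  assumes "linear L" "inj L"
  shows "cross3 (L (axis 1 1)) (L (axis 2 1)) \<noteq> 0"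
proof
  assume "cross3 (L (axis 1 1)) (L (axis 2 1)) = 0"
  then have "collinear {0, L (axis 1 1), L (axis 2 1)}" by (simp add: cross_eq_0)
  moreover have z: "L x = 0 \<Longrightarrow> x = 0" for x
    using assms linear_injective_0 by blast
  ultimately obtain k where "L (axis 2 1) = k *\<^sub>R L (axis 1 1)"
    using z[of "axis 1 1"] z[of "axis 2 1"] by (auto simp: collinear_lemma axis_eq_0_iff)
  then have "L (axis 2 1 - k *\<^sub>R axis 1 1) = 0"
    using assms(1) by (simp add: linear_diff linear_scale)
  from z[OF this] have "(axis 2 1 - k *\<^sub>R axis 1 1 :: real^2) $ 2 = 0" by simp
  then show False by (simp add: axis_def)
qed

text \<open>Being orthogonal to \<open>t2\<close> and \<open>n\<close>, the vector \<open>u\<close> is parallel to \<open>t2 \<times> n\<close>, which is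
  \<open>t1\<close> or \<open>- t1\<close>.\<close>

lemma orthonormal_frame_collinear:
  fixes t1 t2 n u :: "real^3"
  assumes "norm t1 = 1" "norm t2 = 1" "norm n = 1" "t1 \<bullet> t2 = 0" "t1 \<bullet> n = 0" "t2 \<bullet> n = 0"
    and u: "u \<bullet> n = 0" "u \<bullet> t2 = 0"
  shows "u = (u \<bullet> t1) *\<^sub>R t1"
proof -
  define k where "k = t1 \<bullet> cross3 t2 n"
  have k: "cross3 t2 n = k *\<^sub>R t1"
    unfolding k_def by (rule normal_cross[OF assms(1,4,5)])
  have "(norm (cross3 t2 n))\<^sup>2 = 1" using assms norm_cross[of t2 n] by simp
  then have "k \<noteq> 0" using k by auto
  moreover have "k *\<^sub>R cross3 u t1 = 0"
    using u Lagrange[of u t2 n] by (simp add: k cross_mult_right)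
  ultimately have "cross3 t1 (cross3 u t1) = 0" by simp
  then show ?thesis using assms(1) Lagrange[of t1 u t1] by (simp add: norm_eq_1 inner_commute)
qed

text \<open>An alternating form on the plane is a constant multiple of the determinant, so it vanishes once it
  vanishes on one linearly independent pair; \<open>C\<close> witnesses the independence of \<open>u\<close> and \<open>w\<close>.\<close>

lemma alternating_eq_0:
  fixes B C :: "real^2 \<Rightarrow> real^2 \<Rightarrow> 'v::real_vector"
  assumes "bilinear B" "\<And>x. B x x = 0" "bilinear C" "\<And>x. C x x = 0"
    and "B u w = 0" "C u w \<noteq> 0"
  shows "B (axis 1 1) (axis 2 1) = 0"
proof -
  define T where "T x = x $ 1 *\<^sub>R u + x $ 2 *\<^sub>R w" for x :: "real^2"
  have T: "linear T" unfolding T_def by (intro linearI) (simp_all add: algebra_simps)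
  have "T (axis 1 1) = u" "T (axis 2 1) = w" by (simp_all add: T_def axis_def)
  then have "B u w = det (matrix T) *\<^sub>R B (axis 1 1) (axis 2 1)"
    "C u w = det (matrix T) *\<^sub>R C (axis 1 1) (axis 2 1)"
    using det_transforms_alternating[OF assms(1,2) T] det_transforms_alternating[OF assms(3,4) T] by simp_all
  then show ?thesis using assms(5,6) by auto
qed

section \<open>Smooth functions on an immersed surface\<close>

definition C1_map :: "'a chart set \<Rightarrow> ('a \<Rightarrow> 'c::euclidean_space) \<Rightarrow> bool" where
  "C1_map A F \<longleftrightarrow> (\<forall>c\<in>A. C_k_on 1 (F \<circ> chart_inv c) (snd c ` fst c))"

lemma smooth_map_C_k: "smooth_map A F \<Longrightarrow> c \<in> A \<Longrightarrow> C_k_on k (F \<circ> chart_inv c) (snd c ` fst c)"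
  unfolding smooth_map_def smooth_on_def by blast

lemma smooth_map_C1: "smooth_map A F \<Longrightarrow> C1_map A F"
  unfolding C1_map_def using smooth_map_C_k by blast

lemma C1_map_const: "C1_map A (\<lambda>p. c)"
  unfolding C1_map_def comp_def using C1_const by blast

lemma C1_map_bilinear:
  assumes "bounded_bilinear B" "C1_map A F" "C1_map A G"
  shows "C1_map A (\<lambda>p. B (F p) (G p))"
  using C1_bilinear[OF assms(1)] assms(2,3) unfolding C1_map_def comp_def by blast

lemma C1_map_add: "C1_map A F \<Longrightarrow> C1_map A G \<Longrightarrow> C1_map A (\<lambda>p. F p + G p)"
  unfolding C1_map_def comp_def by (intro ballI C1_add; blast)

lemma C1_map_sum: "(\<And>i. i \<in> I \<Longrightarrow> C1_map A (F i)) \<Longrightarrow> C1_map A (\<lambda>p. \<Sum>i\<in>I. F i p)"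
  unfolding C1_map_def comp_def by (intro ballI C1_sum) blast

lemma C1_map_scaleR:
  "C1_map A f \<Longrightarrow> C1_map A F \<Longrightarrow> C1_map A (\<lambda>p. f p *\<^sub>R F p)"
  by (rule C1_map_bilinear[OF bounded_bilinear_scaleR])

locale immersed_surface =
  fixes X :: "'a topology" and A :: "'a chart set" and \<psi> N :: "'a \<Rightarrow> real^3"
  assumes surface: "smooth_surface X A"
    and immersion: "immersion A \<psi>"
    and gauss: "gauss_map A \<psi> N"
begin

lemma chart: "c \<in> A \<Longrightarrow> is_chart X c"
  using surface unfolding smooth_surface_def smooth_atlas_def by blast

lemma chart_open: "c \<in> A \<Longrightarrow> openin X (fst c)"
  using chart unfolding is_chart_def by blast

lemma coords_open: "c \<in> A \<Longrightarrow> open (snd c ` fst c)"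
  using chart unfolding is_chart_def by blast

lemma charts_cover:
  assumes "p \<in> topspace X"
  obtains c where "c \<in> A" "p \<in> fst c"
  using assms surface unfolding smooth_surface_def smooth_atlas_def by blast

lemma chart_subset: "c \<in> A \<Longrightarrow> fst c \<subseteq> topspace X"
  using chart_open openin_subset by blast

lemma immersion_C_k: "c \<in> A \<Longrightarrow> C_k_on k (\<psi> \<circ> chart_inv c) (snd c ` fst c)"
  using immersion smooth_map_C_k unfolding immersion_def by blast

lemma gauss_C1: "C1_map A N"
  using gauss smooth_map_C1 unfolding gauss_map_def by blast

lemma immersion_C1: "C1_map A \<psi>"
  using immersion smooth_map_C1 unfolding immersion_def by blast

lemma gauss_unit: "c \<in> A \<Longrightarrow> p \<in> fst c \<Longrightarrow> norm (N p) = 1"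
  and gauss_normal: "c \<in> A \<Longrightarrow> p \<in> fst c \<Longrightarrow> N p \<bullet> chart_diff c \<psi> p w = 0"
  using gauss unfolding gauss_map_def by blast+

lemma chart_diff_cong:
  assumes "c \<in> A" "openin X V" "p \<in> fst c \<inter> V" "\<And>q. q \<in> fst c \<inter> V \<Longrightarrow> F q = G q"
  shows "chart_diff c F p = chart_diff c G p"
  unfolding chart_diff_def
  by (rule frechet_derivative_cong_open[OF chart_image_open[OF chart assms(2)]])
    (use assms chart_inv_left[OF chart[OF assms(1)]] in auto)

lemma has_derivative_chart:
  assumes "C1_map A F" "c \<in> A" "p \<in> fst c"
  shows "((F \<circ> chart_inv c) has_derivative chart_diff c F p) (at (snd c p))"
  using assms unfolding chart_diff_def C1_map_def C1_iff
  by (intro frechet_derivative_works[THEN iffD1]) blast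

lemma linear_chart_diff: "C1_map A F \<Longrightarrow> c \<in> A \<Longrightarrow> p \<in> fst c \<Longrightarrow> linear (chart_diff c F p)"
  using has_derivative_chart has_derivative_linear by blast

lemma chart_diff_eqI:
  "((F \<circ> chart_inv c) has_derivative D) (at (snd c p)) \<Longrightarrow> chart_diff c F p = D"
  unfolding chart_diff_def using frechet_derivative_at by metis

lemma chart_diff_bilinear:
  assumes B: "bounded_bilinear B" and "C1_map A F" "C1_map A G" "c \<in> A" "p \<in> fst c"
  shows "chart_diff c (\<lambda>p. B (F p) (G p)) p =
    (\<lambda>w. B (F p) (chart_diff c G p w) + B (chart_diff c F p w) (G p))"
  using bounded_bilinear.FDERIV[OF B has_derivative_chart[OF assms(2,4,5)] has_derivative_chart[OF assms(3,4,5)]]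
  by (intro chart_diff_eqI) (simp add: comp_def chart_inv_left[OF chart[OF assms(4)] assms(5)])

lemma chart_diff_sum:
  assumes "\<And>i. i \<in> I \<Longrightarrow> C1_map A (F i)" "c \<in> A" "p \<in> fst c"
  shows "chart_diff c (\<lambda>p. \<Sum>i\<in>I. F i p) p = (\<lambda>w. \<Sum>i\<in>I. chart_diff c (F i) p w)"
proof (rule chart_diff_eqI)
  have "((\<lambda>x. \<Sum>i\<in>I. (F i \<circ> chart_inv c) x) has_derivative (\<lambda>w. \<Sum>i\<in>I. chart_diff c (F i) p w)) (at (snd c p))"
    by (intro has_derivative_sum has_derivative_chart assms)
  then show "((\<lambda>p. \<Sum>i\<in>I. F i p) \<circ> chart_inv c has_derivative (\<lambda>w. \<Sum>i\<in>I. chart_diff c (F i) p w)) (at (snd c p))"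
    by (simp add: comp_def)
qed

subsection \<open>Changing charts\<close>

definition transition_diff :: "'a chart \<Rightarrow> 'a chart \<Rightarrow> 'a \<Rightarrow> real^2 \<Rightarrow> real^2" where
  "transition_diff c d p = frechet_derivative (snd d \<circ> chart_inv c) (at (snd c p))"

lemma overlap_open: "c \<in> A \<Longrightarrow> d \<in> A \<Longrightarrow> open (snd c ` (fst c \<inter> fst d))"
  using chart_image_open chart chart_open by blast

lemma transition_C1: "c \<in> A \<Longrightarrow> d \<in> A \<Longrightarrow> C_k_on 1 (snd d \<circ> chart_inv c) (snd c ` (fst c \<inter> fst d))"
  using surface unfolding smooth_surface_def smooth_atlas_def smooth_on_def by blast

lemma transition_has_derivative:
  assumes "c \<in> A" "d \<in> A" "p \<in> fst c \<inter> fst d"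
  shows "((snd d \<circ> chart_inv c) has_derivative transition_diff c d p) (at (snd c p))"
  unfolding transition_diff_def
  using transition_C1[OF assms(1,2)] assms(3) unfolding C1_iff
  by (intro frechet_derivative_works[THEN iffD1]) blast

lemma transition_apply:
  assumes "c \<in> A" "p \<in> fst c"
  shows "(snd d \<circ> chart_inv c) (snd c p) = snd d p"
  using chart_inv_left[OF chart] assms by simp

lemma chart_diff_transition:
  assumes "c \<in> A" "d \<in> A" "p \<in> fst c \<inter> fst d" "C1_map A F"
  shows "chart_diff c F p = chart_diff d F p \<circ> transition_diff c d p"
proof (rule chart_diff_eqI)
  have "((F \<circ> chart_inv d) has_derivative chart_diff d F p) (at ((snd d \<circ> chart_inv c) (snd c p)))"
    using has_derivative_chart[OF assms(4,2)] assms(3)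
    by (subst transition_apply[OF assms(1)]) auto
  with transition_has_derivative[OF assms(1-3)]
  have "((\<lambda>x. (F \<circ> chart_inv d) ((snd d \<circ> chart_inv c) x)) has_derivative
      (\<lambda>w. chart_diff d F p (transition_diff c d p w))) (at (snd c p))"
    by (rule has_derivative_compose)
  then have "((F \<circ> chart_inv c) has_derivative
      (\<lambda>w. chart_diff d F p (transition_diff c d p w))) (at (snd c p))"
  proof (rule has_derivative_transform_within_open[OF _ overlap_open[OF assms(1,2)]])
    show "snd c p \<in> snd c ` (fst c \<inter> fst d)" using assms by auto
    show "(F \<circ> chart_inv d) ((snd d \<circ> chart_inv c) x) = (F \<circ> chart_inv c) x"
      if "x \<in> snd c ` (fst c \<inter> fst d)" for x
      using that chart_inv_left[OF chart[OF assms(1)]] chart_inv_left[OF chart[OF assms(2)]] by auto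
  qed
  then show "((F \<circ> chart_inv c) has_derivative chart_diff d F p \<circ> transition_diff c d p) (at (snd c p))"
    by (simp add: comp_def)
qed

text \<open>Up to sign this is the square root of the Gram determinant; the sign says whether the chart induces
  the orientation given by \<open>N\<close>.\<close>

definition area_density :: "'a chart \<Rightarrow> 'a \<Rightarrow> real" where
  "area_density c p =
    N p \<bullet> cross3 (chart_diff c \<psi> p (axis 1 1)) (chart_diff c \<psi> p (axis 2 1))"

text \<open>The coefficient of the exterior derivative of the 1-form \<open>F \<bullet> d\<psi>\<close>. The second derivatives of
  \<open>\<psi>\<close> cancel in it.\<close>

definition curl_density :: "'a chart \<Rightarrow> ('a \<Rightarrow> real^3) \<Rightarrow> 'a \<Rightarrow> real" where
  "curl_density c F p = chart_diff c F p (axis 1 1) \<bullet> chart_diff c \<psi> p (axis 2 1)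
              - chart_diff c F p (axis 2 1) \<bullet> chart_diff c \<psi> p (axis 1 1)"

lemma area_density_nonzero:
  assumes "c \<in> A" "p \<in> fst c"
  shows "area_density c p \<noteq> 0"
  using normal_cross[OF gauss_unit[OF assms] gauss_normal[OF assms] gauss_normal[OF assms]]
    cross_nonzero_of_inj[OF linear_chart_diff[OF immersion_C1 assms]] immersion assms
  unfolding immersion_def area_density_def by (metis scaleR_zero_left)

lemma area_density_transition:
  assumes "c \<in> A" "d \<in> A" "p \<in> fst c \<inter> fst d"
  shows "area_density c p = det (matrix (transition_diff c d p)) * area_density d p"
proof -
  have L: "linear (chart_diff d \<psi> p)" using linear_chart_diff[OF immersion_C1] assms by blast
  have "bilinear (\<lambda>x y. N p \<bullet> cross3 (chart_diff d \<psi> p x) (chart_diff d \<psi> p y))"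
    unfolding bilinear_def
    by (intro conjI allI linearI)
      (simp_all add: linear_add[OF L] linear_scale[OF L] cross_add_left cross_add_right
        cross_mult_left cross_mult_right inner_add_right)
  from det_transforms_alternating[OF this _ has_derivative_linear[OF transition_has_derivative[OF assms]]]
  show ?thesis
    unfolding area_density_def chart_diff_transition[OF assms immersion_C1] by simp
qed

lemma curl_density_transition:
  assumes "c \<in> A" "d \<in> A" "p \<in> fst c \<inter> fst d" "C1_map A F"
  shows "curl_density c F p = det (matrix (transition_diff c d p)) * curl_density d F p"
proof -
  have L: "linear (chart_diff d \<psi> p)" "linear (chart_diff d F p)"
    using linear_chart_diff[OF immersion_C1] linear_chart_diff[OF assms(4)] assms by blast+
  have "bilinear (\<lambda>x y. chart_diff d F p x \<bullet> chart_diff d \<psi> p y - chart_diff d F p y \<bullet> chart_diff d \<psi> p x)"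
    unfolding bilinear_def
    by (intro conjI allI linearI)
      (simp_all add: linear_add[OF L(1)] linear_add[OF L(2)] linear_scale[OF L(1)] linear_scale[OF L(2)]
        inner_add_left inner_add_right right_diff_distrib)
  from det_transforms_alternating[OF this _ has_derivative_linear[OF transition_has_derivative[OF assms(1-3)]]]
  show ?thesis
    unfolding curl_density_def chart_diff_transition[OF assms(1-3) immersion_C1] chart_diff_transition[OF assms]
    by simp
qed

text \<open>Both densities are multiplied by the same determinant under a change of charts, so their quotient
  is a function on the surface: \<open>d(F \<bullet> d\<psi>) = scalar_curl F dA\<close> for the area form \<open>dA\<close> of the
  orientation given by \<open>N\<close>.\<close>

definition scalar_curl :: "('a \<Rightarrow> real^3) \<Rightarrow> 'a \<Rightarrow> real" where
  "scalar_curl F p = (let c = SOME c. c \<in> A \<and> p \<in> fst c in curl_density c F p / area_density c p)"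

lemma scalar_curl_eq:
  assumes "c \<in> A" "p \<in> fst c" "C1_map A F"
  shows "scalar_curl F p = curl_density c F p / area_density c p"
proof -
  define d where "d = (SOME c. c \<in> A \<and> p \<in> fst c)"
  have d: "d \<in> A" "p \<in> fst d"
    using someI[of "\<lambda>c. c \<in> A \<and> p \<in> fst c" c] assms by (auto simp: d_def)
  have "area_density c p \<noteq> 0" "area_density d p \<noteq> 0"
    using area_density_nonzero assms d by auto
  then show ?thesis
    using area_density_transition[of c d p] curl_density_transition[of c d p F] assms d
    unfolding scalar_curl_def d_def[symmetric] Let_def by (auto simp: field_simps)
qed

lemma continuous_on_chart_diff:
  assumes "c \<in> A" "C1_map A F"
  shows "continuous_on (snd c ` fst c) (\<lambda>x. chart_diff c F (chart_inv c x) w)"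
proof -
  have "continuous_on (snd c ` fst c) (\<lambda>x. frechet_derivative (F \<circ> chart_inv c) (at x) w)"
    using assms unfolding C1_map_def C1_iff by blast
  then show ?thesis
    unfolding chart_diff_def by (simp add: chart_inv_right cong: continuous_on_cong)
qed

lemma continuous_on_C1_map:
  assumes "c \<in> A" "C1_map A F"
  shows "continuous_on (snd c ` fst c) (\<lambda>x. F (chart_inv c x))"
proof -
  have "C_k_on 1 (F \<circ> chart_inv c) (snd c ` fst c)" using assms unfolding C1_map_def by blast
  from C_k_on_continuous[OF this] show ?thesis by (simp add: comp_def)
qed

lemma continuous_on_area_density:
  assumes "c \<in> A"
  shows "continuous_on (snd c ` fst c) (\<lambda>x. area_density c (chart_inv c x))"
  using continuous_on_inner[OF continuous_on_C1_map[OF assms gauss_C1]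
      continuous_on_cross[OF continuous_on_chart_diff[OF assms immersion_C1, of "axis 1 1"]
        continuous_on_chart_diff[OF assms immersion_C1, of "axis 2 1"]]]
  unfolding area_density_def .

lemma continuous_on_scalar_curl:
  assumes "c \<in> A" "C1_map A F"
  shows "continuous_on (snd c ` fst c) (\<lambda>x. scalar_curl F (chart_inv c x))"
proof -
  have "continuous_on (snd c ` fst c) (\<lambda>x. curl_density c F (chart_inv c x) / area_density c (chart_inv c x))"
  proof (rule continuous_on_divide[OF _ continuous_on_area_density[OF assms(1)]])
    show "continuous_on (snd c ` fst c) (\<lambda>x. curl_density c F (chart_inv c x))"
      unfolding curl_density_def
      by (rule continuous_on_diff[OF
            continuous_on_inner[OF continuous_on_chart_diff[OF assms] continuous_on_chart_diff[OF assms(1) immersion_C1]]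
            continuous_on_inner[OF continuous_on_chart_diff[OF assms] continuous_on_chart_diff[OF assms(1) immersion_C1]]])
    show "\<forall>x\<in>snd c ` fst c. area_density c (chart_inv c x) \<noteq> 0"
      by (intro ballI area_density_nonzero[OF assms(1)] chart_inv_right(2))
  qed
  then show ?thesis
    by (rule continuous_on_eq) (rule scalar_curl_eq[OF assms(1) chart_inv_right(2) assms(2), symmetric])
qed

lemma scalar_curl_eq_0_open:
  assumes "C1_map A F" "openin X V" "p \<in> V" "\<And>q. q \<in> V \<Longrightarrow> F q = 0"
  shows "scalar_curl F p = 0"
proof -
  have "p \<in> topspace X" using assms openin_subset by blast
  then obtain c where c: "c \<in> A" "p \<in> fst c" by (rule charts_cover)
  have "chart_diff c F p = chart_diff c (\<lambda>_. 0) p"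
    by (rule chart_diff_cong[OF c(1) assms(2)]) (use assms c in auto)
  then have "chart_diff c F p w = 0" for w
    by (simp add: chart_diff_def comp_def frechet_derivative_const)
  then show ?thesis using scalar_curl_eq[OF c assms(1)] by (simp add: curl_density_def)
qed

lemma scalar_curl_sum:
  assumes "\<And>i. i \<in> I \<Longrightarrow> C1_map A (F i)" "p \<in> topspace X"
  shows "scalar_curl (\<lambda>p. \<Sum>i\<in>I. F i p) p = (\<Sum>i\<in>I. scalar_curl (F i) p)"
proof -
  obtain c where c: "c \<in> A" "p \<in> fst c" using assms charts_cover by blast
  have "scalar_curl (\<lambda>p. \<Sum>i\<in>I. F i p) p = (\<Sum>i\<in>I. curl_density c (F i) p / area_density c p)"
    using scalar_curl_eq[OF c C1_map_sum[of I A F, OF assms(1)]] chart_diff_sum[of I F, OF assms(1) c]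
    by (simp add: curl_density_def inner_sum_left sum_subtractf flip: sum_divide_distrib)
  then show ?thesis using scalar_curl_eq[OF c assms(1)] by simp
qed

lemma scalar_curl_cong:
  assumes "C1_map A F" "C1_map A G" "p \<in> topspace X" "\<And>q. q \<in> topspace X \<Longrightarrow> F q = G q"
  shows "scalar_curl F p = scalar_curl G p"
proof -
  obtain c where c: "c \<in> A" "p \<in> fst c" using assms charts_cover by blast
  have "chart_diff c F p = chart_diff c G p"
    by (rule chart_diff_cong[OF c(1) openin_topspace]) (use assms c in auto)
  then show ?thesis using scalar_curl_eq[OF c] assms by (simp add: curl_density_def)
qed

end

section \<open>Integration on an immersed surface\<close>

lemma compact_support_absolutely_integrable:
  fixes f :: "'a::euclidean_space \<Rightarrow> real"
  assumes "compact L" "L \<subseteq> S" "continuous_on S f" "\<And>x. x \<in> S - L \<Longrightarrow> f x = 0"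
  shows "f absolutely_integrable_on S"
proof -
  have "set_integrable lborel L f"
    unfolding set_integrable_def using assms
    by (intro borel_integrable_compact) (auto intro: continuous_on_subset)
  then have "f absolutely_integrable_on L"
    unfolding set_integrable_def
    by (intro integrable_completion[THEN iffD2]) (auto intro: borel_measurable_integrable)
  then have "(\<lambda>x. if x \<in> L then f x else 0) absolutely_integrable_on UNIV"
    using absolutely_integrable_restrict_UNIV by blast
  moreover have "(\<lambda>x. if x \<in> L then f x else 0) = (\<lambda>x. if x \<in> S then f x else 0)"
    using assms by (auto simp: fun_eq_iff)
  ultimately show ?thesis using absolutely_integrable_restrict_UNIV by metis
qed

text \<open>The change of variables theorem is stated for vector-valued functions; \<open>real\<close> is identified with
  \<open>real^1\<close>.\<close>

lemma integral_change_of_variables_real: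
  fixes f :: "real^'m::{finite,wellorder} \<Rightarrow> real" and g :: "real^'m::_ \<Rightarrow> real^'m::_"
  assumes "S \<in> sets lebesgue" "\<And>x. x \<in> S \<Longrightarrow> (g has_derivative g' x) (at x within S)"
    and "inj_on g S" "f absolutely_integrable_on (g ` S)"
  shows "integral S (\<lambda>x. \<bar>det (matrix (g' x))\<bar> * f (g x)) = integral (g ` S) f"
proof -
  have "(\<lambda>x. vec (f x) :: real^1) absolutely_integrable_on (g ` S)"
    using assms(4) by (simp add: absolutely_integrable_on_1_iff)
  with has_absolute_integral_change_of_variables[OF assms(1-3), of "\<lambda>x. vec (f x) :: real^1"]
  have "(\<lambda>x. \<bar>det (matrix (g' x))\<bar> *\<^sub>R (vec (f (g x)) :: real^1)) absolutely_integrable_on S"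
    and *: "integral S (\<lambda>x. \<bar>det (matrix (g' x))\<bar> *\<^sub>R (vec (f (g x)) :: real^1))
       = integral (g ` S) (\<lambda>x. vec (f x))"
    by blast+
  then have "(\<lambda>x. \<bar>det (matrix (g' x))\<bar> *\<^sub>R (vec (f (g x)) :: real^1)) integrable_on S"
    using absolutely_integrable_on_def by blast
  moreover have "(\<lambda>x. vec (f x) :: real^1) integrable_on g ` S"
    using \<open>(\<lambda>x. vec (f x) :: real^1) absolutely_integrable_on (g ` S)\<close> absolutely_integrable_on_def by blast
  ultimately show ?thesis
    using * by (simp add: integral_on_1_eq)
qed

lemma integral_eq_subset:
  fixes f :: "'a::euclidean_space \<Rightarrow> real"
  assumes "T \<subseteq> S" "\<And>x. x \<in> S - T \<Longrightarrow> f x = 0"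
  shows "integral S f = integral T f"
proof -
  have "(\<lambda>x. if x \<in> S then f x else 0) = (\<lambda>x. if x \<in> T then f x else 0)"
    using assms by (auto simp: fun_eq_iff)
  then show ?thesis using integral_restrict_UNIV by metis
qed

lemma integral_nonneg_continuous_eq_0:
  fixes f :: "'a::euclidean_space \<Rightarrow> real"
  assumes S: "open S" and f: "continuous_on S f" "f absolutely_integrable_on S"
    and nonneg: "\<And>x. x \<in> S \<Longrightarrow> 0 \<le> f x" and 0: "integral S f = 0" and x: "x \<in> S"
  shows "f x = 0"
proof -
  obtain a b where ab: "x \<in> box a b" "cbox a b \<subseteq> S"
    using S x open_contains_cbox by metis
  have cont: "continuous_on (cbox a b) f" using f(1) ab(2) continuous_on_subset by blast
  have int: "f integrable_on cbox a b" using cont integrable_continuous by blast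
  have "integral (cbox a b) f \<le> integral S f"
    using ab(2) int f(2) nonneg by (intro integral_subset_le) (auto simp: absolutely_integrable_on_def)
  moreover have "integral (cbox a b) f \<ge> 0"
    using ab(2) nonneg by (intro integral_nonneg int) auto
  ultimately have "(f has_integral 0) (cbox a b)"
    using int 0 by (simp add: has_integral_iff)
  from has_integral_0_cbox_imp_0[OF cont _ this, of x] show ?thesis
    using ab nonneg box_subset_cbox by blast
qed

context immersed_surface
begin

lemma hausdorff: "Hausdorff_space X"
  using surface unfolding smooth_surface_def by blast

lemma chart_inv_off:
  assumes "c \<in> A" "x \<in> snd c ` fst c - snd c ` K"
  shows "chart_inv c x \<in> topspace X - K"
proof -
  have x: "x \<in> snd c ` fst c" using assms(2) by blast
  have "chart_inv c x \<notin> K"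
  proof
    assume "chart_inv c x \<in> K"
    then have "snd c (chart_inv c x) \<in> snd c ` K" by (rule imageI)
    then show False using assms(2) chart_inv_right(1)[OF x] by simp
  qed
  then show ?thesis using chart_inv_right(2)[OF x] chart_subset[OF assms(1)] by blast
qed

text \<open>The integral over a chart domain with respect to the area measure of the induced metric.\<close>

definition chart_integral :: "'a chart \<Rightarrow> ('a \<Rightarrow> real) \<Rightarrow> real" where
  "chart_integral c f =
     integral (snd c ` fst c) (\<lambda>x. f (chart_inv c x) * \<bar>area_density c (chart_inv c x)\<bar>)"

text \<open>Continuity is asked for in charts, because that is the form in which integrands are used.\<close>

definition chart_continuous :: "('a \<Rightarrow> real) \<Rightarrow> bool" where
  "chart_continuous f \<longleftrightarrow> (\<forall>c\<in>A. continuous_on (snd c ` fst c) (\<lambda>x. f (chart_inv c x)))"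

definition supported_in :: "'a chart \<Rightarrow> ('a \<Rightarrow> 'b::zero) \<Rightarrow> bool" where
  "supported_in c f \<longleftrightarrow> (\<exists>K. compactin X K \<and> K \<subseteq> fst c \<and> (\<forall>p\<in>topspace X - K. f p = 0))"

lemma continuous_on_chart_integrand:
  "c \<in> A \<Longrightarrow> chart_continuous f \<Longrightarrow> continuous_on (snd c ` fst c)
     (\<lambda>x. f (chart_inv c x) * \<bar>area_density c (chart_inv c x)\<bar>)"
  using continuous_on_area_density unfolding chart_continuous_def
  by (intro continuous_on_mult continuous_on_rabs) auto

lemma chart_integrand_integrable:
  assumes "c \<in> A" "chart_continuous f" "supported_in c f"
  shows "(\<lambda>x. f (chart_inv c x) * \<bar>area_density c (chart_inv c x)\<bar>)
           absolutely_integrable_on snd c ` fst c"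
proof -
  obtain K where K: "compactin X K" "K \<subseteq> fst c" "\<And>p. p \<in> topspace X - K \<Longrightarrow> f p = 0"
    using assms(3) unfolding supported_in_def by blast
  show ?thesis
  proof (rule compact_support_absolutely_integrable)
    show "compact (snd c ` K)" using K chart_compact_image_iff[OF chart[OF assms(1)]] by blast
    show "snd c ` K \<subseteq> snd c ` fst c" using K by blast
    show "f (chart_inv c x) * \<bar>area_density c (chart_inv c x)\<bar> = 0"
      if "x \<in> snd c ` fst c - snd c ` K" for x
      using K(3)[OF chart_inv_off[OF assms(1) that]] by simp
  qed (rule continuous_on_chart_integrand[OF assms(1,2)])
qed

lemma chart_integral_change:
  assumes cd: "c \<in> A" "d \<in> A" and f: "chart_continuous f" "supported_in c f" "supported_in d f"
  shows "chart_integral c f = chart_integral d f"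
proof -
  define W where "W = fst c \<inter> fst d"
  define \<tau> where "\<tau> = snd d \<circ> chart_inv c"
  define g where "g c x = f (chart_inv c x) * \<bar>area_density c (chart_inv c x)\<bar>" for c x
  have f0: "f p = 0" if "p \<in> topspace X" "p \<notin> W" for p
    using f(2,3) that unfolding supported_in_def W_def by blast
  have inv: "chart_inv c (snd c p) = p" "chart_inv d (snd d p) = p" "\<tau> (snd c p) = snd d p" if "p \<in> W" for p
    using that chart_inv_left[OF chart[OF cd(1)]] chart_inv_left[OF chart[OF cd(2)]]
    by (simp_all add: W_def \<tau>_def)
  have image: "\<tau> ` snd c ` W = snd d ` W"
    unfolding image_image by (rule image_cong[OF refl inv(3)])
  have red: "chart_integral e f = integral (snd e ` W) (g e)" if "e \<in> A" "W \<subseteq> fst e" for e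
    unfolding chart_integral_def g_def[symmetric]
  proof (rule integral_eq_subset)
    show "snd e ` W \<subseteq> snd e ` fst e" using that by blast
    show "g e x = 0" if x: "x \<in> snd e ` fst e - snd e ` W" for x
    proof -
      have "chart_inv e x \<in> topspace X - W" by (rule chart_inv_off[OF \<open>e \<in> A\<close> x])
      then have "f (chart_inv e x) = 0" by (intro f0) auto
      then show ?thesis by (simp add: g_def)
    qed
  qed
  have op: "open (snd c ` W)" "open (snd d ` W)"
    using overlap_open[OF cd] overlap_open[OF cd(2,1)] by (simp_all only: W_def Int_commute)
  have abs_int: "g d absolutely_integrable_on \<tau> ` snd c ` W"
    unfolding image
    by (rule set_integrable_subset[OF chart_integrand_integrable[OF cd(2) f(1,3), folded g_def]])
      (use op in \<open>simp_all add: W_def image_mono\<close>)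
  have "chart_integral d f = integral (\<tau> ` snd c ` W) (g d)"
    unfolding image by (rule red[OF cd(2)]) (simp add: W_def)
  also have "\<dots> = integral (snd c ` W) (\<lambda>x. \<bar>det (matrix (transition_diff c d (chart_inv c x)))\<bar> * g d (\<tau> x))"
  proof (rule integral_change_of_variables_real[symmetric, OF _ _ _ abs_int])
    show "snd c ` W \<in> sets lebesgue" using op by simp
    show "(\<tau> has_derivative transition_diff c d (chart_inv c x)) (at x within snd c ` W)"
      if x: "x \<in> snd c ` W" for x
    proof -
      obtain p where p: "p \<in> W" "x = snd c p" using x by blast
      then have "(\<tau> has_derivative transition_diff c d p) (at x)"
        using transition_has_derivative[OF cd, of p] by (simp add: \<tau>_def W_def)
      then show ?thesis using p inv(1)[OF p(1)] by (simp add: has_derivative_at_withinI)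
    qed
    show "inj_on \<tau> (snd c ` W)"
    proof (rule inj_onI)
      fix x y assume "x \<in> snd c ` W" "y \<in> snd c ` W" and eq: "\<tau> x = \<tau> y"
      then obtain p q where pq: "p \<in> W" "x = snd c p" "q \<in> W" "y = snd c q" by blast
      then have "snd d p = snd d q" using eq inv(3)[OF pq(1)] inv(3)[OF pq(3)] by simp
      then have "chart_inv d (snd d p) = chart_inv d (snd d q)" by (rule arg_cong)
      then have "p = q" unfolding inv(2)[OF pq(1)] inv(2)[OF pq(3)] .
      then show "x = y" unfolding pq(2,4) by (rule arg_cong)
    qed
  qed
  also have "\<dots> = integral (snd c ` W) (g c)"
  proof (rule Henstock_Kurzweil_Integration.integral_cong)
    fix x assume "x \<in> snd c ` W"
    then obtain p where p: "p \<in> W" "x = snd c p" by blast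
    have "area_density c p = det (matrix (transition_diff c d p)) * area_density d p"
      using area_density_transition[OF cd] p by (simp add: W_def)
    then show "\<bar>det (matrix (transition_diff c d (chart_inv c x)))\<bar> * g d (\<tau> x) = g c x"
      using inv[OF p(1)] by (simp add: g_def p(2) abs_mult)
  qed
  also have "\<dots> = chart_integral c f"
    by (rule red[OF cd(1), symmetric]) (simp add: W_def)
  finally show ?thesis by simp
qed

lemma chart_integral_sum:
  assumes "c \<in> A" "\<And>i. i \<in> I \<Longrightarrow> chart_continuous (f i)" "\<And>i. i \<in> I \<Longrightarrow> supported_in c (f i)"
    and "finite I"
  shows "chart_integral c (\<lambda>p. \<Sum>i\<in>I. f i p) = (\<Sum>i\<in>I. chart_integral c (f i))"
  unfolding chart_integral_def sum_distrib_right
  by (rule integral_sum) (use chart_integrand_integrable assms in \<open>auto simp: absolutely_integrable_on_def\<close>)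

lemma chart_integral_nonneg:
  assumes "c \<in> A" "chart_continuous f" "supported_in c f" "\<And>p. p \<in> fst c \<Longrightarrow> 0 \<le> f p"
  shows "0 \<le> chart_integral c f"
    and "chart_integral c f = 0 \<Longrightarrow> p \<in> fst c \<Longrightarrow> f p = 0"
proof -
  let ?g = "\<lambda>x. f (chart_inv c x) * \<bar>area_density c (chart_inv c x)\<bar>"
  note int = chart_integrand_integrable[OF assms(1-3)]
  have nonneg: "0 \<le> ?g x" if "x \<in> snd c ` fst c" for x
    using assms(4) chart_inv_right(2)[OF that] by simp
  show "0 \<le> chart_integral c f"
    unfolding chart_integral_def
    by (rule integral_nonneg[OF _ nonneg]) (use int in \<open>auto simp: absolutely_integrable_on_def\<close>)
  assume 0: "chart_integral c f = 0" and p: "p \<in> fst c"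
  have "?g (snd c p) = 0"
    by (rule integral_nonneg_continuous_eq_0[OF coords_open[OF assms(1)]
          continuous_on_chart_integrand[OF assms(1,2)] int nonneg])
      (use 0 p in \<open>auto simp: chart_integral_def\<close>)
  then show "f p = 0"
    using area_density_nonzero[OF assms(1) p] by (simp add: chart_inv_left[OF chart[OF assms(1)] p])
qed

text \<open>A chart domain need not be connected, so the orientation given by the chart may agree with \<open>N\<close> on
  some components only; the locally constant sign of the area density is moved into \<open>F\<close>.\<close>

lemma chart_integral_scalar_curl_eq_0:
  assumes c: "c \<in> A" and F: "C1_map A F" and supp: "supported_in c F"
  shows "chart_integral c (scalar_curl F) = 0"
proof -
  let ?S = "snd c ` fst c"
  let ?a = "\<lambda>x. area_density c (chart_inv c x)"
  obtain K where K: "compactin X K" "K \<subseteq> fst c" "\<And>p. p \<in> topspace X - K \<Longrightarrow> F p = 0"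
    using supp unfolding supported_in_def by blast
  define P where "P s = ?S \<inter> (\<lambda>x. s * ?a x) -` {0<..}" for s :: real
  have opP: "open (P s)" for s
    unfolding P_def
    by (intro continuous_open_preimage coords_open[OF c] open_greaterThan
        continuous_on_mult continuous_on_const continuous_on_area_density[OF c])
  have cover: "?S = P 1 \<union> P (-1)"
    using area_density_nonzero[OF c chart_inv_right(2)] by (fastforce simp: P_def)
  define G where "G x = sgn (?a x) *\<^sub>R F (chart_inv c x)" for x
  have F': "C_k_on 1 (\<lambda>x. F (chart_inv c x)) ?S"
    using F c unfolding C1_map_def comp_def by blast
  have G_on: "C_k_on 1 G (P s)" "\<And>x. x \<in> P s \<Longrightarrow> s *\<^sub>R F (chart_inv c x) = G x" if "s = 1 \<or> s = -1" for s
  proof -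
    show G: "s *\<^sub>R F (chart_inv c x) = G x" if "x \<in> P s" for x
      using that \<open>s = 1 \<or> s = -1\<close> by (auto simp: P_def G_def sgn_if)
    have "C_k_on 1 (\<lambda>x. s *\<^sub>R F (chart_inv c x)) (P s)"
      by (rule C1_bilinear[OF bounded_bilinear_scaleR C1_const C_k_on_subset[OF F']]) (simp add: P_def)
    then show "C_k_on 1 G (P s)"
      using C_k_on_cong[of "P s" "\<lambda>x. s *\<^sub>R F (chart_inv c x)" G 1, OF opP G] by blast
  qed
  have G: "C_k_on 1 G ?S"
    unfolding cover by (intro C_k_on_Un opP G_on) auto
  have dG: "frechet_derivative G (at x) w = sgn (?a x) *\<^sub>R chart_diff c F (chart_inv c x) w" if x: "x \<in> ?S" for x w
  proof -
    obtain s where s: "s = 1 \<or> s = -1" "x \<in> P s" using x cover by blast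
    have "((\<lambda>x. s *\<^sub>R F (chart_inv c x)) has_derivative (\<lambda>w. s *\<^sub>R chart_diff c F (chart_inv c x) w)) (at x)"
      using has_derivative_chart[OF F c chart_inv_right(2)[OF x]] chart_inv_right(1)[OF x]
      by (intro has_derivative_scaleR_right) (simp add: comp_def)
    from frechet_derivative_at[OF this]
    have "frechet_derivative G (at x) = (\<lambda>w. s *\<^sub>R chart_diff c F (chart_inv c x) w)"
      using frechet_derivative_cong_open[OF opP s(2) G_on(2)[OF s(1)]] by simp
    moreover have "sgn (?a x) = s" using s by (auto simp: P_def sgn_if)
    ultimately show ?thesis by simp
  qed
  have d\<psi>: "frechet_derivative (\<psi> \<circ> chart_inv c) (at x) w = chart_diff c \<psi> (chart_inv c x) w"
    if "x \<in> ?S" for x w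
    unfolding chart_diff_def using chart_inv_right(1)[OF that] by simp
  have "chart_integral c (scalar_curl F) =
    integral ?S (\<lambda>x. frechet_derivative G (at x) (axis 1 1) \<bullet> frechet_derivative (\<psi> \<circ> chart_inv c) (at x) (axis 2 1)
       - frechet_derivative G (at x) (axis 2 1) \<bullet> frechet_derivative (\<psi> \<circ> chart_inv c) (at x) (axis 1 1))"
    unfolding chart_integral_def
  proof (rule Henstock_Kurzweil_Integration.integral_cong)
    fix x assume x: "x \<in> ?S"
    have p: "chart_inv c x \<in> fst c" using chart_inv_right(2)[OF x] .
    have "scalar_curl F (chart_inv c x) * \<bar>?a x\<bar> = sgn (?a x) * curl_density c F (chart_inv c x)"
      using area_density_nonzero[OF c p] scalar_curl_eq[OF c p F]
      by (simp add: sgn_if abs_if)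
    then show "scalar_curl F (chart_inv c x) * \<bar>?a x\<bar> =
        frechet_derivative G (at x) (axis 1 1) \<bullet> frechet_derivative (\<psi> \<circ> chart_inv c) (at x) (axis 2 1)
       - frechet_derivative G (at x) (axis 2 1) \<bullet> frechet_derivative (\<psi> \<circ> chart_inv c) (at x) (axis 1 1)"
      using x by (simp add: dG d\<psi> curl_density_def right_diff_distrib)
  qed
  also have "\<dots> = 0"
  proof (rule stokes_compact_support[OF coords_open[OF c] G immersion_C_k[OF c]])
    show "compact (snd c ` K)" using K chart_compact_image_iff[OF chart[OF c]] by blast
    show "snd c ` K \<subseteq> ?S" using K by blast
    show "G x = 0" if "x \<in> ?S - snd c ` K" for x
      using K(3)[OF chart_inv_off[OF c that]] by (simp add: G_def)
  qed
  finally show ?thesis .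
qed

end

section \<open>Stokes' theorem on a closed surface\<close>

text \<open>The square turns the kink of the positive part into a \<open>C\<^sup>1\<close> point, so the squared positive part of
  \<open>r - \<bar>x - a\<bar>\<^sup>2\<close> is a \<open>C\<^sup>1\<close> bump function.\<close>

lemma C1_positive_part_square: "C_k_on 1 (\<lambda>s::real. (max 0 s)^2) UNIV"
proof (rule C1I)
  have "((\<lambda>s. (max 0 s)^2) has_real_derivative 2 * max 0 x) (at x)" for x :: real
  proof (cases x "0::real" rule: linorder_cases)
    case less
    have "((\<lambda>s. 0) has_real_derivative 2 * max 0 x) (at x)" using less by simp
    then show ?thesis
      by (rule has_field_derivative_transform_within_open[of _ _ _ "{..<0}"]) (use less in auto)
  next
    case greater
    have "((\<lambda>s. s^2) has_real_derivative 2 * max 0 x) (at x)"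
      using greater by (auto intro!: derivative_eq_intros)
    then show ?thesis
      by (rule has_field_derivative_transform_within_open[of _ _ _ "{0<..}"]) (use greater in auto)
  next
    case equal
    have "((\<lambda>h. (max 0 h)^2 / h) \<longlongrightarrow> 0) (at (0::real))"
    proof (rule Lim_null_comparison)
      show "\<forall>\<^sub>F h in at 0. norm ((max 0 h)^2 / h) \<le> \<bar>h\<bar>"
        by (rule always_eventually) (auto simp: max_def power2_eq_square)
      show "((\<lambda>h. \<bar>h\<bar>) \<longlongrightarrow> 0) (at (0::real))" by (auto intro!: tendsto_eq_intros)
    qed
    then show ?thesis using equal by (simp add: DERIV_def)
  qed
  then show "((\<lambda>s. (max 0 s)^2) has_derivative (*) (2 * max 0 x)) (at x)" for x :: real
    by (simp add: has_field_derivative_def)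
  show "continuous_on UNIV (\<lambda>x. 2 * max 0 x * w)" for w :: real
    by (intro continuous_intros)
qed

lemma C1_quadratic_bump:
  fixes a :: "'b::euclidean_space"
  shows "C_k_on 1 (\<lambda>x. (max 0 (r - (x - a) \<bullet> (x - a)))^2) UNIV"
proof (rule C1_compose[OF C1_positive_part_square])
  show "C_k_on 1 (\<lambda>x. r - (x - a) \<bullet> (x - a)) UNIV"
  proof (rule C1I)
    show "((\<lambda>x. r - (x - a) \<bullet> (x - a)) has_derivative (\<lambda>w. - (2 * ((x - a) \<bullet> w)))) (at x)" for x
      by (auto intro!: derivative_eq_intros simp: inner_commute)
    show "continuous_on UNIV (\<lambda>x. - (2 * ((x - a) \<bullet> w)))" for w
      by (intro continuous_intros)
  qed
qed simp

context immersed_surface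
begin

lemma supported_inI: "compactin X K \<Longrightarrow> K \<subseteq> fst c \<Longrightarrow> (\<And>p. p \<in> topspace X - K \<Longrightarrow> f p = 0) \<Longrightarrow> supported_in c f"
  unfolding supported_in_def by blast

lemma bump_function:
  assumes "p \<in> topspace X"
  obtains c b U where "c \<in> A" "C1_map A b" "supported_in c b" "\<And>q. (b q :: real) \<ge> 0"
    "openin X U" "p \<in> U" "\<And>q. q \<in> U \<Longrightarrow> b q > 0"
proof -
  obtain c where c: "c \<in> A" "p \<in> fst c" using assms by (rule charts_cover)
  let ?a = "snd c p"
  obtain r where r: "r > 0" "cball ?a r \<subseteq> snd c ` fst c"
    using coords_open[OF c(1)] c(2) open_contains_cball by blast
  define \<beta> where "\<beta> x = (max 0 (r^2 - (x - ?a) \<bullet> (x - ?a)))^2" for x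
  have \<beta>_pos: "\<beta> x > 0" if "x \<in> ball ?a r" for x
  proof -
    have "norm (x - ?a) < r" using that by (simp add: dist_norm norm_minus_commute)
    then have "(x - ?a) \<bullet> (x - ?a) < r^2"
      by (metis norm_ge_zero power2_norm_eq_inner power_strict_mono zero_less_numeral)
    then show ?thesis by (simp add: \<beta>_def)
  qed
  have \<beta>_0: "\<beta> x = 0" if "x \<notin> cball ?a r" for x
  proof -
    have "norm (x - ?a) > r" using that by (simp add: dist_norm norm_minus_commute)
    then have "(x - ?a) \<bullet> (x - ?a) > r^2"
      using r(1) by (metis less_imp_le power2_norm_eq_inner power_strict_mono zero_less_numeral)
    then show ?thesis by (simp add: \<beta>_def)
  qed
  have \<beta>_C1: "C_k_on 1 \<beta> UNIV" unfolding \<beta>_def by (rule C1_quadratic_bump)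
  define b where "b q = (if q \<in> fst c then \<beta> (snd c q) else 0)" for q
  define K where "K = {q \<in> fst c. snd c q \<in> cball ?a r}"
  have "snd c ` K = cball ?a r" using r(2) unfolding K_def by auto
  then have K: "compactin X K" "K \<subseteq> fst c"
    using chart_compact_image_iff[OF chart[OF c(1)], of K] by (auto simp: K_def)
  have b0: "b q = 0" if "q \<notin> K" for q
    using that \<beta>_0 by (auto simp: b_def K_def)
  have opK: "openin X (topspace X - K)"
    using compactin_imp_closedin[OF hausdorff K(1)] by blast
  have "C1_map A b"
    unfolding C1_map_def
  proof
    fix d assume d: "d \<in> A"
    let ?V = "snd d ` (fst d \<inter> fst c)" and ?W = "snd d ` (fst d \<inter> (topspace X - K))"
    have inv: "chart_inv d (snd d q) = q" if "q \<in> fst d" for q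
      using chart_inv_left[OF chart[OF d] that] .
    have "C_k_on 1 (\<lambda>x. \<beta> ((snd c \<circ> chart_inv d) x)) ?V"
      by (rule C1_compose[OF \<beta>_C1 transition_C1[OF d c(1)]]) simp
    then have V: "C_k_on 1 (b \<circ> chart_inv d) ?V"
      by (rule C_k_on_cong[OF overlap_open[OF d c(1)], rotated]) (auto simp: b_def inv)
    have W: "C_k_on 1 (b \<circ> chart_inv d) ?W"
      by (rule C_k_on_cong[OF chart_image_open[OF chart[OF d] opK] _ C1_const[of 0]])
        (auto simp: b0 inv)
    \<comment> \<open>\<open>b\<close> is \<open>\<beta>\<close> in the chart \<open>c\<close> and zero off the compact, hence closed, set \<open>K\<close>; these two
      regions cover the domain of \<open>d\<close>.\<close>
    have "snd d ` fst d = ?V \<union> ?W" using K(2) chart_subset[OF d] by blast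
    then show "C_k_on 1 (b \<circ> chart_inv d) (snd d ` fst d)"
      using C_k_on_Un[OF overlap_open[OF d c(1)] chart_image_open[OF chart[OF d] opK] V W] by simp
  qed
  moreover have "supported_in c b" by (rule supported_inI[OF K]) (use b0 in auto)
  moreover have "b q \<ge> 0" for q by (simp add: b_def \<beta>_def)
  moreover have "openin X {q \<in> fst c. snd c q \<in> ball ?a r}"
    by (rule chart_preimage_open[OF chart[OF c(1)] open_ball])
  moreover have "p \<in> {q \<in> fst c. snd c q \<in> ball ?a r}" using c r by simp
  moreover have "b q > 0" if "q \<in> {q \<in> fst c. snd c q \<in> ball ?a r}" for q
    using that \<beta>_pos by (simp add: b_def)
  ultimately show thesis using that[OF c(1)] by blast
qed

lemma supported_in_mult:
  fixes f g :: "'a \<Rightarrow> real"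
  assumes "supported_in c f" shows "supported_in c (\<lambda>p. f p * g p)"
  using assms unfolding supported_in_def by fastforce

lemma partition_of_unity:
  assumes "compact_space X"
  obtains I :: "'a set" and c \<eta> where "finite I" "\<And>i. i \<in> I \<Longrightarrow> c i \<in> A"
    "\<And>i. i \<in> I \<Longrightarrow> C1_map A (\<eta> i)" "\<And>i. i \<in> I \<Longrightarrow> supported_in (c i) (\<eta> i)"
    "\<And>i p. i \<in> I \<Longrightarrow> p \<in> topspace X \<Longrightarrow> (\<eta> i p :: real) \<ge> 0"
    "\<And>p. p \<in> topspace X \<Longrightarrow> (\<Sum>i\<in>I. \<eta> i p) = 1"
proof -
  have "\<exists>c b U. c \<in> A \<and> C1_map A b \<and> supported_in c b \<and> (\<forall>q. (b q :: real) \<ge> 0) \<and>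
      openin X U \<and> p \<in> U \<and> (\<forall>q\<in>U. b q > 0)" if "p \<in> topspace X" for p
    using bump_function[OF that] by metis
  then obtain c b U where *: "\<And>p. p \<in> topspace X \<Longrightarrow> c p \<in> A \<and> C1_map A (b p) \<and> supported_in (c p) (b p) \<and>
      (\<forall>q. (b p q :: real) \<ge> 0) \<and> openin X (U p) \<and> p \<in> U p \<and> (\<forall>q\<in>U p. b p q > 0)"
    by metis
  have "\<exists>F. finite F \<and> F \<subseteq> U ` topspace X \<and> topspace X \<subseteq> \<Union>F"
    by (rule compactinD[of X "topspace X"])
      (use assms * in \<open>auto simp: compact_space_def\<close>)
  then obtain I where I: "finite I" "I \<subseteq> topspace X" "topspace X \<subseteq> (\<Union>p\<in>I. U p)"
    by (metis finite_subset_image)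
  define S where "S q = (\<Sum>i\<in>I. b i q)" for q
  have S_pos: "S q > 0" if q: "q \<in> topspace X" for q
  proof -
    obtain i where i: "i \<in> I" "q \<in> U i" using I(3) q by blast
    have "0 < b i q" using * i I(2) by blast
    also have "\<dots> \<le> S q" unfolding S_def
      by (rule member_le_sum) (use * i I in auto)
    finally show ?thesis .
  qed
  have S_C1: "C1_map A S" unfolding S_def by (rule C1_map_sum) (use * I(2) in blast)
  have inv_C1: "C1_map A (\<lambda>q. inverse (S q))"
    unfolding C1_map_def comp_def
  proof
    fix d assume d: "d \<in> A"
    have "S (chart_inv d x) \<noteq> 0" if "x \<in> snd d ` fst d" for x
      using S_pos[of "chart_inv d x"] chart_inv_right(2)[OF that] chart_subset[OF d] by auto
    then show "C_k_on 1 (\<lambda>x. inverse (S (chart_inv d x))) (snd d ` fst d)"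
      using S_C1 d by (intro C1_inverse) (auto simp: C1_map_def comp_def simp del: C_k_on.simps One_nat_def)
  qed
  show thesis
  proof (rule that[OF I(1), of c "\<lambda>i q. b i q * inverse (S q)"])
    show "c i \<in> A" if "i \<in> I" for i using * I that by blast
    show "C1_map A (\<lambda>q. b i q * inverse (S q))" if "i \<in> I" for i
      by (rule C1_map_bilinear[OF bounded_bilinear_mult _ inv_C1]) (use * I that in blast)
    show "supported_in (c i) (\<lambda>q. b i q * inverse (S q))" if "i \<in> I" for i
      by (rule supported_in_mult) (use * I that in blast)
    show "b i p * inverse (S p) \<ge> 0" if "i \<in> I" "p \<in> topspace X" for i p
      using * I that S_pos[OF that(2)] by (simp add: subset_iff)
    show "(\<Sum>i\<in>I. b i p * inverse (S p)) = 1" if "p \<in> topspace X" for p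
      using S_pos[OF that] by (simp add: sum_distrib_right[symmetric] S_def[symmetric])
  qed
qed

lemma chart_continuous_C1: "C1_map A f \<Longrightarrow> chart_continuous f"
  unfolding chart_continuous_def using continuous_on_C1_map by blast

lemma chart_continuous_scalar_curl: "C1_map A F \<Longrightarrow> chart_continuous (scalar_curl F)"
  unfolding chart_continuous_def using continuous_on_scalar_curl by blast

lemma chart_continuous_mult:
  "chart_continuous f \<Longrightarrow> chart_continuous g \<Longrightarrow> chart_continuous (\<lambda>p. f p * g p)"
  unfolding chart_continuous_def by (intro ballI continuous_on_mult) auto

lemma chart_integral_cong:
  assumes "c \<in> A" "\<And>p. p \<in> topspace X \<Longrightarrow> f p = g p"
  shows "chart_integral c f = chart_integral c g"
  unfolding chart_integral_def
proof (rule Henstock_Kurzweil_Integration.integral_cong)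
  fix x assume x: "x \<in> snd c ` fst c"
  have "chart_inv c x \<in> topspace X"
    by (rule subsetD[OF chart_subset[OF assms(1)] chart_inv_right(2)[OF x]])
  then show "f (chart_inv c x) * \<bar>area_density c (chart_inv c x)\<bar> = g (chart_inv c x) * \<bar>area_density c (chart_inv c x)\<bar>"
    using assms(2) by simp
qed

lemma supported_in_scalar_curl:
  assumes "C1_map A F" "supported_in c F"
  shows "supported_in c (scalar_curl F)"
proof -
  obtain K where K: "compactin X K" "K \<subseteq> fst c" "\<And>p. p \<in> topspace X - K \<Longrightarrow> F p = 0"
    using assms(2) unfolding supported_in_def by blast
  have "openin X (topspace X - K)"
    using compactin_imp_closedin[OF hausdorff K(1)] by blast
  then show ?thesis using scalar_curl_eq_0_open[OF assms(1)] K by (intro supported_inI[OF K(1,2)]) blast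
qed

text \<open>By Stokes' theorem \<open>scalar_curl F\<close> has integral zero, so it vanishes if it is nonnegative. The integral over the surface is
  \<open>f \<mapsto> \<Sum>\<^sub>j \<integral> \<eta>\<^sub>j f dA\<close> for a partition of unity \<open>\<eta>\<close>, the \<open>j\<close>-th term being computed in the chart
  \<open>c j\<close>. On functions supported in a single chart it agrees with the integral in that chart, since
  integrals do not depend on the chart. Hence it vanishes on \<open>scalar_curl (\<eta>\<^sub>i F)\<close> for each \<open>i\<close>, and
  on the sum of these functions, which is \<open>scalar_curl F\<close>.\<close>

theorem scalar_curl_nonneg_eq_0:
  assumes compact: "compact_space X" and F: "C1_map A F"
    and nonneg: "\<And>p. p \<in> topspace X \<Longrightarrow> 0 \<le> scalar_curl F p" and p: "p \<in> topspace X"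
  shows "scalar_curl F p = 0"
proof -
  obtain I :: "'a set" and c \<eta> where I: "finite I" and c: "\<And>i. i \<in> I \<Longrightarrow> c i \<in> A"
    and \<eta>: "\<And>i. i \<in> I \<Longrightarrow> C1_map A (\<eta> i)" "\<And>i. i \<in> I \<Longrightarrow> supported_in (c i) (\<eta> i)"
    and \<eta>0: "\<And>i p. i \<in> I \<Longrightarrow> p \<in> topspace X \<Longrightarrow> (\<eta> i p :: real) \<ge> 0"
    and \<eta>1: "\<And>p. p \<in> topspace X \<Longrightarrow> (\<Sum>i\<in>I. \<eta> i p) = 1"
    by (rule partition_of_unity[OF compact]) blast
  define G where "G i q = \<eta> i q *\<^sub>R F q" for i q
  have G: "C1_map A (G i)" "supported_in (c i) (G i)" if "i \<in> I" for i
  proof -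
    show "C1_map A (G i)" unfolding G_def by (rule C1_map_scaleR[OF \<eta>(1)[OF that] F])
    show "supported_in (c i) (G i)"
      using \<eta>(2)[OF that] unfolding G_def supported_in_def by fastforce
  qed
  have sum_G: "(\<Sum>i\<in>I. scalar_curl (G i) q) = scalar_curl F q" if q: "q \<in> topspace X" for q
  proof -
    have "scalar_curl F q = scalar_curl (\<lambda>q. \<Sum>i\<in>I. G i q) q"
      by (rule scalar_curl_cong[OF F C1_map_sum[OF G(1)] q])
        (simp_all add: G_def scaleR_sum_left[symmetric] \<eta>1)
    also have "\<dots> = (\<Sum>i\<in>I. scalar_curl (G i) q)"
      by (rule scalar_curl_sum[OF G(1) q])
    finally show ?thesis by simp
  qed
  have cont: "chart_continuous (\<lambda>q. \<eta> j q * scalar_curl (G i) q)" if "i \<in> I" "j \<in> I" for i j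
    by (intro chart_continuous_mult chart_continuous_C1 chart_continuous_scalar_curl \<eta> G that)
  have supp_j: "supported_in (c j) (\<lambda>q. \<eta> j q * scalar_curl (G i) q)" if "j \<in> I" for i j
    by (rule supported_in_mult[OF \<eta>(2)[OF that]])
  have supp_i: "supported_in (c i) (\<lambda>q. \<eta> j q * scalar_curl (G i) q)" if "i \<in> I" for i j
    using supported_in_mult[OF supported_in_scalar_curl[OF G[OF that]], of "\<eta> j"] by (simp add: mult.commute)
  have zero: "(\<Sum>j\<in>I. chart_integral (c j) (\<lambda>q. \<eta> j q * scalar_curl (G i) q)) = 0" if i: "i \<in> I" for i
  proof -
    have "(\<Sum>j\<in>I. chart_integral (c j) (\<lambda>q. \<eta> j q * scalar_curl (G i) q))
        = (\<Sum>j\<in>I. chart_integral (c i) (\<lambda>q. \<eta> j q * scalar_curl (G i) q))"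
      by (intro sum.cong refl chart_integral_change c cont supp_i supp_j i)
    also have "\<dots> = chart_integral (c i) (\<lambda>q. \<Sum>j\<in>I. \<eta> j q * scalar_curl (G i) q)"
      by (rule chart_integral_sum[symmetric]) (intro c cont supp_i i I; assumption)+
    also have "\<dots> = chart_integral (c i) (scalar_curl (G i))"
      by (rule chart_integral_cong[OF c[OF i]]) (simp add: sum_distrib_right[symmetric] \<eta>1)
    also have "\<dots> = 0" by (rule chart_integral_scalar_curl_eq_0[OF c[OF i] G[OF i]])
    finally show ?thesis .
  qed
  have contF: "chart_continuous (\<lambda>q. \<eta> j q * scalar_curl F q)" if "j \<in> I" for j
    by (intro chart_continuous_mult chart_continuous_C1 chart_continuous_scalar_curl \<eta> F that)
  have suppF: "supported_in (c j) (\<lambda>q. \<eta> j q * scalar_curl F q)" if "j \<in> I" for j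
    by (rule supported_in_mult[OF \<eta>(2)[OF that]])
  have pos: "0 \<le> \<eta> j q * scalar_curl F q" if "j \<in> I" "q \<in> fst (c j)" for j q
    using \<eta>0[OF that(1)] nonneg that(2) chart_subset[OF c[OF that(1)]] by (auto intro!: mult_nonneg_nonneg)
  have "(\<Sum>j\<in>I. chart_integral (c j) (\<lambda>q. \<eta> j q * scalar_curl F q))
      = (\<Sum>j\<in>I. chart_integral (c j) (\<lambda>q. \<Sum>i\<in>I. \<eta> j q * scalar_curl (G i) q))"
    by (intro sum.cong refl chart_integral_cong c) (simp_all add: sum_distrib_left[symmetric] sum_G)
  also have "\<dots> = (\<Sum>j\<in>I. \<Sum>i\<in>I. chart_integral (c j) (\<lambda>q. \<eta> j q * scalar_curl (G i) q))"
    by (rule sum.cong[OF refl], rule chart_integral_sum) (intro c cont supp_j I; assumption)+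
  also have "\<dots> = (\<Sum>i\<in>I. \<Sum>j\<in>I. chart_integral (c j) (\<lambda>q. \<eta> j q * scalar_curl (G i) q))"
    by (rule sum.swap)
  also have "\<dots> = 0" by (simp add: zero)
  finally have total: "(\<Sum>j\<in>I. chart_integral (c j) (\<lambda>q. \<eta> j q * scalar_curl F q)) = 0" .
  have each: "chart_integral (c j) (\<lambda>q. \<eta> j q * scalar_curl F q) = 0" if j: "j \<in> I" for j
  proof -
    have "0 \<le> chart_integral (c i) (\<lambda>q. \<eta> i q * scalar_curl F q)" if i: "i \<in> I" for i
      by (rule chart_integral_nonneg(1)[OF c[OF i] contF[OF i] suppF[OF i] pos[OF i]])
    then have "\<forall>i\<in>I. chart_integral (c i) (\<lambda>q. \<eta> i q * scalar_curl F q) = 0"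
      using total by (subst (asm) sum_nonneg_eq_0_iff[OF I])
    then show ?thesis using j by (rule bspec)
  qed
  have "\<eta> j p * scalar_curl F p = 0" if j: "j \<in> I" for j
  proof (cases "p \<in> fst (c j)")
    case True
    then show ?thesis
      by (intro chart_integral_nonneg(2)[OF c[OF j] contF[OF j] suppF[OF j] pos[OF j] each[OF j]])
  next
    case False
    then have "\<eta> j p = 0" using \<eta>(2)[OF j] p unfolding supported_in_def by blast
    then show ?thesis by simp
  qed
  then have "(\<Sum>j\<in>I. \<eta> j p) * scalar_curl F p = 0"
    unfolding sum_distrib_right by (intro sum.neutral) blast
  then show ?thesis by (simp add: \<eta>1[OF p])
qed

end

section \<open>The mean curvature\<close>

text \<open>The angle is half the polar angle of \<open>((a - d) / 2, b)\<close>.\<close>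

lemma rotation_diagonalizes:
  fixes a b d :: real
  obtains t where "(d - a) * (cos t * sin t) + b * ((cos t)\<^sup>2 - (sin t)\<^sup>2) = 0"
proof -
  obtain r s where rs: "(a - d) / 2 = r * cos s" "b = r * sin s" using polar_Ex by blast
  have half: "sin s = 2 * sin (s/2) * cos (s/2)" "cos s = (cos (s/2))\<^sup>2 - (sin (s/2))\<^sup>2"
    using sin_double[of "s/2"] cos_double[of "s/2"] by simp_all
  have da: "d - a = - 2 * (r * cos s)" using rs(1) by (simp add: field_simps)
  have "(d - a) * (cos (s/2) * sin (s/2)) + b * ((cos (s/2))\<^sup>2 - (sin (s/2))\<^sup>2) = 0"
    unfolding rs(2) da half by (simp add: algebra_simps)
  then show thesis by (rule that)
qed

context immersed_surface
begin

text \<open>Differentiate \<open>N \<bullet> N = 1\<close>.\<close>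

lemma gauss_derivative_tangential:
  assumes "c \<in> A" "p \<in> fst c"
  shows "N p \<bullet> chart_diff c N p w = 0"
proof -
  have "chart_diff c (\<lambda>p. N p \<bullet> N p) p = chart_diff c (\<lambda>p. 1::real) p"
    by (rule chart_diff_cong[OF assms(1) openin_topspace])
      (use assms chart_subset[OF assms(1)] gauss_unit[OF assms(1)] in \<open>auto simp: norm_eq_1\<close>)
  moreover have "chart_diff c (\<lambda>p. 1::real) p w = 0"
    by (simp add: chart_diff_def comp_def frechet_derivative_const)
  ultimately show ?thesis
    using fun_cong[OF chart_diff_bilinear[OF bounded_bilinear_inner gauss_C1 gauss_C1 assms], of w]
    by (simp add: inner_commute)
qed

text \<open>Differentiating \<open>N \<bullet> d\<psi> w = 0\<close> in the direction \<open>u\<close> gives \<open>dN u \<bullet> d\<psi> w = - N \<bullet> D\<^sup>2\<psi>(u,w)\<close>, which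
  is symmetric.\<close>

lemma shape_operator_symmetric:
  assumes c: "c \<in> A" and p: "p \<in> fst c"
  shows "chart_diff c N p u \<bullet> chart_diff c \<psi> p w = chart_diff c N p w \<bullet> chart_diff c \<psi> p u"
proof -
  let ?S = "snd c ` fst c" and ?x = "snd c p"
  let ?f = "\<psi> \<circ> chart_inv c"
  let ?D = "\<lambda>w y. frechet_derivative ?f (at y) w"
  have x: "?x \<in> ?S" using p by blast
  have f: "C_k_on 2 ?f ?S" by (rule immersion_C_k[OF c])
  have "chart_diff c N p u \<bullet> chart_diff c \<psi> p w = - (N p \<bullet> frechet_derivative (?D w) (at ?x) u)" for u w
  proof -
    have "((\<lambda>y. (N \<circ> chart_inv c) y \<bullet> ?D w y) has_derivative
      (\<lambda>u. (N \<circ> chart_inv c) ?x \<bullet> frechet_derivative (?D w) (at ?x) u + chart_diff c N p u \<bullet> ?D w ?x)) (at ?x)"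
      by (rule bounded_bilinear.FDERIV[OF bounded_bilinear_inner has_derivative_chart[OF gauss_C1 c p]])
        (use C_k_on_2D[OF f] x in \<open>auto intro: frechet_derivative_works[THEN iffD1]\<close>)
    note D = this
    have "(N \<circ> chart_inv c) y \<bullet> ?D w y = 0" if "y \<in> ?S" for y
      using gauss_normal[OF c chart_inv_right(2)[OF that], of w] chart_inv_right(1)[OF that]
      by (simp add: chart_diff_def)
    then have "((\<lambda>y. (N \<circ> chart_inv c) y \<bullet> ?D w y) has_derivative (\<lambda>u. 0)) (at ?x)"
      by (intro has_derivative_transform_within_open[OF has_derivative_const coords_open[OF c] x]) auto
    from fun_cong[OF has_derivative_unique[OF D this], of u]
    have "(N \<circ> chart_inv c) ?x \<bullet> frechet_derivative (?D w) (at ?x) u + chart_diff c N p u \<bullet> ?D w ?x = 0" .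
    then show ?thesis
      by (simp add: chart_diff_def chart_inv_left[OF chart[OF c] p])
  qed
  then show ?thesis using second_derivative_symmetric[OF f coords_open[OF c] x] by simp
qed

text \<open>The definition of \<open>mean_curvature\<close> by a definite description has content only if principal directions
  exist. Gram-Schmidt applied to the coordinate vectors gives an orthonormal frame of the tangent plane,
  and a rotation of that frame diagonalizes the symmetric shape operator.\<close>

lemma principal_curvatures_exist:
  assumes c: "c \<in> A" and p: "p \<in> fst c"
  shows "\<exists>\<kappa>\<^sub>1 \<kappa>\<^sub>2. principal_curvatures A \<psi> N p \<kappa>\<^sub>1 \<kappa>\<^sub>2"
proof -
  let ?L = "chart_diff c \<psi> p" and ?M = "chart_diff c N p"
  have L: "linear ?L" using linear_chart_diff[OF immersion_C1 c p] .
  have M: "linear ?M" using linear_chart_diff[OF gauss_C1 c p] .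
  have "inj ?L" using immersion c p unfolding immersion_def by blast
  then have L0: "?L x = 0 \<Longrightarrow> x = 0" for x using L linear_injective_0 by blast
  define normalize where "normalize x = inverse (norm (?L x)) *\<^sub>R x" for x
  have unit: "norm (?L (normalize x)) = 1" if "x \<noteq> 0" for x
  proof -
    have "norm (?L x) \<noteq> 0" using L0[of x] that by auto
    then show ?thesis by (simp add: normalize_def linear_scale[OF L])
  qed
  define f1 where "f1 = normalize (axis 1 1)"
  define g where "g = axis 2 1 - (?L (axis 2 1) \<bullet> ?L f1) *\<^sub>R f1"
  define f2 where "f2 = normalize g"
  have "g $ 2 = 1" by (simp add: g_def f1_def normalize_def axis_def)
  then have g0: "g \<noteq> 0" by auto
  have n1: "norm (?L f1) = 1" unfolding f1_def by (rule unit) (simp add: axis_eq_0_iff)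
  have n2: "norm (?L f2) = 1" unfolding f2_def by (rule unit[OF g0])
  have "?L g \<bullet> ?L f1 = 0"
    using n1 by (simp add: g_def linear_diff[OF L] linear_scale[OF L] inner_diff_left norm_eq_1)
  then have n12: "?L f1 \<bullet> ?L f2 = 0"
    by (simp add: f2_def normalize_def linear_scale[OF L] inner_commute)
  define a b d where "a = ?M f1 \<bullet> ?L f1" and "b = ?M f1 \<bullet> ?L f2" and "d = ?M f2 \<bullet> ?L f2"
  have b: "?M f2 \<bullet> ?L f1 = b" unfolding b_def by (rule shape_operator_symmetric[OF c p])
  obtain t where t: "(d - a) * (cos t * sin t) + b * ((cos t)\<^sup>2 - (sin t)\<^sup>2) = 0"
    by (rule rotation_diagonalizes)
  define e1 where "e1 = cos t *\<^sub>R f1 + sin t *\<^sub>R f2"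
  define e2 where "e2 = - sin t *\<^sub>R f1 + cos t *\<^sub>R f2"
  note lin = linear_add[OF L] linear_scale[OF L] linear_add[OF M] linear_scale[OF M]
    linear_diff[OF L] linear_diff[OF M] linear_neg[OF L] linear_neg[OF M]
  note ip = inner_add_left inner_add_right inner_diff_left inner_diff_right
  have o: "?L f1 \<bullet> ?L f1 = 1" "?L f2 \<bullet> ?L f2 = 1" "?L f1 \<bullet> ?L f2 = 0" "?L f2 \<bullet> ?L f1 = 0"
    using n1 n2 n12 by (simp_all add: norm_eq_1 inner_commute)
  have e11: "norm (?L e1) = 1" and e22: "norm (?L e2) = 1"
    unfolding norm_eq_1 by (simp_all add: e1_def e2_def lin ip o flip: power2_eq_square)
  have e12: "?L e1 \<bullet> ?L e2 = 0" by (simp add: e1_def e2_def lin ip o mult.commute)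
  have Me12: "?M e1 \<bullet> ?L e2 = 0"
  proof -
    have "?M e1 \<bullet> ?L e2 = (d - a) * (cos t * sin t) + b * ((cos t)\<^sup>2 - (sin t)\<^sup>2)"
      by (simp add: e1_def e2_def lin ip b a_def[symmetric] b_def[symmetric] d_def[symmetric]
          power2_eq_square algebra_simps)
    then show ?thesis using t by simp
  qed
  then have Me21: "?M e2 \<bullet> ?L e1 = 0" using shape_operator_symmetric[OF c p, of e1 e2] by simp
  have nrm: "norm (N p) = 1" "N p \<bullet> ?L w = 0" "?L w \<bullet> N p = 0" "?M w \<bullet> N p = 0" for w
    using gauss_unit[OF c p] gauss_normal[OF c p] gauss_derivative_tangential[OF c p]
    by (simp_all add: inner_commute)
  have "?M e1 = (?M e1 \<bullet> ?L e1) *\<^sub>R ?L e1"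
    by (rule orthonormal_frame_collinear[OF e11 e22 nrm(1) e12 nrm(3,3,4) Me12])
  then have k1: "- ?M e1 = (- (?M e1 \<bullet> ?L e1)) *\<^sub>R ?L e1" by simp
  have "?L e2 \<bullet> ?L e1 = 0" using e12 by (simp add: inner_commute)
  then have "?M e2 = (?M e2 \<bullet> ?L e2) *\<^sub>R ?L e2"
    by (rule orthonormal_frame_collinear[OF e22 e11 nrm(1) _ nrm(3,3,4) Me21])
  then have k2: "- ?M e2 = (- (?M e2 \<bullet> ?L e2)) *\<^sub>R ?L e2" by simp
  show ?thesis
    unfolding principal_curvatures_def using c p e11 e22 e12 k1 k2 by blast
qed

text \<open>Since \<open>dN u \<times> d\<psi> w + d\<psi> u \<times> dN w = tr(dN) d\<psi> u \<times> d\<psi> w\<close>, the form vanishes if and only if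
  \<open>k\<close> is the trace of \<open>- dN\<close>. It expresses the trace without a choice of orthonormal frame, and it is
  alternating, so it can be compared between charts.\<close>

definition trace_form :: "real \<Rightarrow> 'a chart \<Rightarrow> 'a \<Rightarrow> real^2 \<Rightarrow> real^2 \<Rightarrow> real^3" where
  "trace_form k c p u w = cross3 (chart_diff c N p u) (chart_diff c \<psi> p w)
     + cross3 (chart_diff c \<psi> p u) (chart_diff c N p w)
     + k *\<^sub>R cross3 (chart_diff c \<psi> p u) (chart_diff c \<psi> p w)"

lemma trace_form_bilinear:
  assumes "c \<in> A" "p \<in> fst c"
  shows "bilinear (trace_form k c p)"
proof -
  note L = linear_chart_diff[OF immersion_C1 assms] and M = linear_chart_diff[OF gauss_C1 assms]
  show ?thesis
    unfolding bilinear_def trace_form_def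
    by (intro conjI allI linearI)
      (simp_all add: linear_add[OF L] linear_scale[OF L] linear_add[OF M] linear_scale[OF M]
        cross_add_left cross_add_right cross_mult_left cross_mult_right scaleR_add_right)
qed

lemma trace_form_alternating: "trace_form k c p u u = 0"
  unfolding trace_form_def using cross_skew[of "chart_diff c N p u" "chart_diff c \<psi> p u"] by simp

lemma trace_form_principal_curvatures:
  assumes pc: "principal_curvatures A \<psi> N p \<kappa>\<^sub>1 \<kappa>\<^sub>2" and d: "d \<in> A" "p \<in> fst d"
  shows "trace_form (\<kappa>\<^sub>1 + \<kappa>\<^sub>2) d p (axis 1 1) (axis 2 1) = 0"
proof -
  let ?k = "\<kappa>\<^sub>1 + \<kappa>\<^sub>2"
  obtain c e1 e2 where c: "c \<in> A" "p \<in> fst c"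
    and e: "norm (chart_diff c \<psi> p e1) = 1" "norm (chart_diff c \<psi> p e2) = 1"
      "chart_diff c \<psi> p e1 \<bullet> chart_diff c \<psi> p e2 = 0"
    and k1: "- chart_diff c N p e1 = \<kappa>\<^sub>1 *\<^sub>R chart_diff c \<psi> p e1"
    and k2: "- chart_diff c N p e2 = \<kappa>\<^sub>2 *\<^sub>R chart_diff c \<psi> p e2"
    using pc unfolding principal_curvatures_def by blast
  note L = linear_chart_diff[OF immersion_C1 c]
  have k1': "chart_diff c N p e1 = (- \<kappa>\<^sub>1) *\<^sub>R chart_diff c \<psi> p e1"
    using k1 by (metis minus_minus scaleR_minus_left)
  have k2': "chart_diff c N p e2 = (- \<kappa>\<^sub>2) *\<^sub>R chart_diff c \<psi> p e2"
    using k2 by (metis minus_minus scaleR_minus_left)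
  have zero: "trace_form ?k c p e1 e2 = 0"
    unfolding trace_form_def k1' k2' by (simp add: cross_mult_left cross_mult_right scaleR_add_left)
  have "(norm (cross3 (chart_diff c \<psi> p e1) (chart_diff c \<psi> p e2)))\<^sup>2 = 1"
    using e norm_cross by simp
  then have nz: "cross3 (chart_diff c \<psi> p e1) (chart_diff c \<psi> p e2) \<noteq> 0" by auto
  have bil: "bilinear (\<lambda>u w. cross3 (chart_diff c \<psi> p u) (chart_diff c \<psi> p w))"
    unfolding bilinear_def
    by (intro conjI allI linearI)
      (simp_all add: linear_add[OF L] linear_scale[OF L] cross_add_left cross_add_right
        cross_mult_left cross_mult_right)
  have c0: "trace_form ?k c p (axis 1 1) (axis 2 1) = 0"
    by (rule alternating_eq_0[OF trace_form_bilinear[OF c] trace_form_alternating bil _ zero nz]) simp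
  have pdc: "p \<in> fst d \<inter> fst c" using c d by blast
  have "trace_form ?k d p (axis 1 1) (axis 2 1)
      = trace_form ?k c p (transition_diff d c p (axis 1 1)) (transition_diff d c p (axis 2 1))"
    unfolding trace_form_def chart_diff_transition[OF d(1) c(1) pdc immersion_C1]
      chart_diff_transition[OF d(1) c(1) pdc gauss_C1] by simp
  also have "\<dots> = det (matrix (transition_diff d c p)) *\<^sub>R trace_form ?k c p (axis 1 1) (axis 2 1)"
    by (rule det_transforms_alternating[OF trace_form_bilinear[OF c] trace_form_alternating
          has_derivative_linear[OF transition_has_derivative[OF d(1) c(1) pdc]]])
  finally show ?thesis using c0 by simp
qed

text \<open>The sum of the principal curvatures is the same for all choices of chart and principal directions,
  because \<open>trace_form\<close> vanishes at no other \<open>k\<close>. Hence \<open>mean_curvature\<close> is half of it.\<close>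

lemma trace_form_mean_curvature:
  assumes c: "c \<in> A" "p \<in> fst c"
  shows "trace_form (2 * mean_curvature A \<psi> N p) c p (axis 1 1) (axis 2 1) = 0"
proof -
  let ?P = "\<lambda>H. \<exists>\<kappa>\<^sub>1 \<kappa>\<^sub>2. principal_curvatures A \<psi> N p \<kappa>\<^sub>1 \<kappa>\<^sub>2 \<and> 2 * H = \<kappa>\<^sub>1 + \<kappa>\<^sub>2"
  have z: "trace_form (2 * H) c p (axis 1 1) (axis 2 1) = 0" if "?P H" for H
    using that trace_form_principal_curvatures c by metis
  have nz: "cross3 (chart_diff c \<psi> p (axis 1 1)) (chart_diff c \<psi> p (axis 2 1)) \<noteq> 0"
    using area_density_nonzero[OF c] by (auto simp: area_density_def)
  obtain \<kappa>\<^sub>1 \<kappa>\<^sub>2 where k: "principal_curvatures A \<psi> N p \<kappa>\<^sub>1 \<kappa>\<^sub>2"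
    using principal_curvatures_exist[OF c] by blast
  have ex: "?P ((\<kappa>\<^sub>1 + \<kappa>\<^sub>2) / 2)" using k by (intro exI[of _ \<kappa>\<^sub>1] exI[of _ \<kappa>\<^sub>2]) simp
  have uniq: "H = H'" if "?P H" "?P H'" for H H'
  proof -
    have "(2 * H - 2 * H') *\<^sub>R cross3 (chart_diff c \<psi> p (axis 1 1)) (chart_diff c \<psi> p (axis 2 1))
        = trace_form (2 * H) c p (axis 1 1) (axis 2 1) - trace_form (2 * H') c p (axis 1 1) (axis 2 1)"
      by (simp add: trace_form_def scaleR_diff_left)
    then show ?thesis using z[OF that(1)] z[OF that(2)] nz by simp
  qed
  have "?P (mean_curvature A \<psi> N p)"
    unfolding mean_curvature_def by (rule theI[of ?P, OF ex]) (use uniq ex in blast)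
  then show ?thesis by (rule z)
qed

section \<open>Closed translating solitons\<close>

lemma bounded_bilinear_cross: "bounded_bilinear cross3"
  using bilinear_cross bilinear_conv_bounded_bilinear by blast

lemma soliton_field_C1: "C1_map A (\<lambda>p. cross3 (N p + l *\<^sub>R \<psi> p) v)"
  by (rule C1_map_bilinear[OF bounded_bilinear_cross
        C1_map_add[OF gauss_C1 C1_map_scaleR[OF C1_map_const immersion_C1]] C1_map_const])

text \<open>The trace identity turns the contribution of \<open>N\<close>
  into \<open>2 H \<langle>N, v\<rangle>\<close>, the contribution of \<open>l \<psi>\<close> is \<open>- 2 l \<langle>N, v\<rangle>\<close>, and the soliton equation makes
  their sum a square.\<close>

lemma scalar_curl_soliton:
  assumes p: "p \<in> topspace X" and H: "2 * mean_curvature A \<psi> N p = 2 * l + N p \<bullet> v"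
  shows "scalar_curl (\<lambda>p. cross3 (N p + l *\<^sub>R \<psi> p) v) p = (N p \<bullet> v)\<^sup>2"
proof -
  let ?Z = "\<lambda>p. N p + l *\<^sub>R \<psi> p"
  obtain c where c: "c \<in> A" "p \<in> fst c" using p by (rule charts_cover)
  let ?M = "\<lambda>w. chart_diff c N p w" and ?L = "\<lambda>w. chart_diff c \<psi> p w"
  have dF: "chart_diff c (\<lambda>p. cross3 (?Z p) v) p = (\<lambda>w. cross3 (?M w + l *\<^sub>R ?L w) v)"
  proof (rule chart_diff_eqI)
    have "((\<lambda>x. cross3 ((N \<circ> chart_inv c) x + l *\<^sub>R (\<psi> \<circ> chart_inv c) x) v) has_derivative
      (\<lambda>w. cross3 (?M w + l *\<^sub>R ?L w) v)) (at (snd c p))"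
      by (intro bounded_linear.has_derivative[OF bounded_bilinear.bounded_linear_left[OF bounded_bilinear_cross]]
          has_derivative_add has_derivative_scaleR_right has_derivative_chart gauss_C1 immersion_C1 c)
    then show "((\<lambda>p. cross3 (?Z p) v) \<circ> chart_inv c has_derivative
      (\<lambda>w. cross3 (?M w + l *\<^sub>R ?L w) v)) (at (snd c p))"
      by (simp add: comp_def)
  qed
  let ?a = "axis 1 1 :: real^2" and ?b = "axis 2 1 :: real^2"
  let ?C = "cross3 (?L ?a) (?L ?b)"
  have triple: "cross3 x v \<bullet> y = - (v \<bullet> cross3 x y)" for x y
    using cross_triple[of x v y] cross_triple[of v y x] cross_skew[of x y] by (simp add: inner_commute)
  have tf: "cross3 (?M ?a) (?L ?b) + cross3 (?L ?a) (?M ?b) = - ((2 * l + N p \<bullet> v) *\<^sub>R ?C)"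
    using trace_form_mean_curvature[OF c] unfolding H trace_form_def
    by (simp add: eq_neg_iff_add_eq_0)
  have "curl_density c (\<lambda>p. cross3 (?Z p) v) p
      = - (v \<bullet> (cross3 (?M ?a) (?L ?b) + cross3 (?L ?a) (?M ?b) + (2 * l) *\<^sub>R ?C))"
    unfolding curl_density_def dF triple
    using cross_skew[of "?M ?b" "?L ?a"] cross_skew[of "?L ?b" "?L ?a"]
    by (simp add: cross_add_left cross_mult_left inner_add_right inner_diff_right)
  also have "\<dots> = (N p \<bullet> v) * (v \<bullet> ?C)"
    unfolding tf by (simp add: inner_diff_right algebra_simps)
  also have "?C = area_density c p *\<^sub>R N p"
    unfolding area_density_def
    by (rule normal_cross[OF gauss_unit[OF c] gauss_normal[OF c] gauss_normal[OF c]])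
  finally have "curl_density c (\<lambda>p. cross3 (?Z p) v) p = (N p \<bullet> v)\<^sup>2 * area_density c p"
    by (simp add: inner_commute power2_eq_square)
  then show ?thesis
    using scalar_curl_eq[OF c soliton_field_C1] area_density_nonzero[OF c] by simp
qed

lemma continuous_map_C1:
  fixes f :: "'a \<Rightarrow> 'c::euclidean_space"
  assumes "C1_map A f"
  shows "continuous_map X euclidean f"
  unfolding continuous_map_def
proof (intro conjI allI impI)
  fix U :: "'c set" assume "openin euclidean U"
  then have U: "open U" by simp
  show "openin X {p \<in> topspace X. f p \<in> U}"
  proof (subst openin_subopen, intro ballI)
    fix p assume "p \<in> {p \<in> topspace X. f p \<in> U}"
    then have p: "p \<in> topspace X" "f p \<in> U" by auto
    obtain c where c: "c \<in> A" "p \<in> fst c" using p(1) by (rule charts_cover)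
    let ?V = "snd c ` fst c \<inter> (\<lambda>x. f (chart_inv c x)) -` U"
    have "open ?V"
      by (rule continuous_open_preimage[OF continuous_on_C1_map[OF c(1) assms] coords_open[OF c(1)] U])
    from chart_preimage_open[OF chart[OF c(1)] this]
    have "openin X {q \<in> fst c. snd c q \<in> ?V}" .
    moreover have "snd c q \<in> ?V \<longleftrightarrow> f q \<in> U" if "q \<in> fst c" for q
      using that by (simp add: chart_inv_left[OF chart[OF c(1)]])
    then have "{q \<in> fst c. snd c q \<in> ?V} = {q \<in> fst c. f q \<in> U}" by blast
    ultimately show "\<exists>T. openin X T \<and> p \<in> T \<and> T \<subseteq> {p \<in> topspace X. f p \<in> U}"
      using c p chart_subset[OF c(1)] by (intro exI[of _ "{q \<in> fst c. f q \<in> U}"]) auto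
  qed
qed auto

text \<open>At a point where the height \<open>\<psi> \<bullet> v\<close> is largest the tangent plane is orthogonal to \<open>v\<close>, so \<open>N\<close>
  is parallel to \<open>v\<close>.\<close>

lemma normal_at_highest_point:
  assumes compact: "compact_space X" and v: "norm v = 1"
  obtains p where "p \<in> topspace X" "N p \<bullet> v \<noteq> 0"
proof -
  let ?h = "\<lambda>p. \<psi> p \<bullet> v"
  have h: "C1_map A ?h" by (rule C1_map_bilinear[OF bounded_bilinear_inner immersion_C1 C1_map_const])
  have "compactin euclidean (?h ` topspace X)"
    using image_compactin[OF _ continuous_map_C1[OF h]] compact unfolding compact_space_def by blast
  moreover have "topspace X \<noteq> {}" using surface unfolding smooth_surface_def by blast
  ultimately obtain p where p: "p \<in> topspace X" "\<And>q. q \<in> topspace X \<Longrightarrow> ?h q \<le> ?h p"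
    using compact_attains_sup[of "?h ` topspace X"] by auto
  obtain c where c: "c \<in> A" "p \<in> fst c" using p(1) by (rule charts_cover)
  have "((\<lambda>x. (\<psi> \<circ> chart_inv c) x \<bullet> v) has_derivative (\<lambda>w. chart_diff c \<psi> p w \<bullet> v)) (at (snd c p))"
    by (intro has_derivative_inner_left has_derivative_chart immersion_C1 c)
  then have "(\<lambda>w. chart_diff c \<psi> p w \<bullet> v) = (\<lambda>w. 0)"
  proof (rule differential_zero_maxmin[OF _ coords_open[OF c(1)], rotated])
    show "snd c p \<in> snd c ` fst c" using c by blast
    have "(\<psi> \<circ> chart_inv c) x \<bullet> v \<le> (\<psi> \<circ> chart_inv c) (snd c p) \<bullet> v" if "x \<in> snd c ` fst c" for x
      using p(2)[of "chart_inv c x"] chart_inv_right(2)[OF that] chart_subset[OF c(1)]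
        chart_inv_left[OF chart[OF c(1)] c(2)] by auto
    then show "(\<forall>y\<in>snd c ` fst c. (\<psi> \<circ> chart_inv c) y \<bullet> v \<le> (\<psi> \<circ> chart_inv c) (snd c p) \<bullet> v) \<or>
      (\<forall>y\<in>snd c ` fst c. (\<psi> \<circ> chart_inv c) (snd c p) \<bullet> v \<le> (\<psi> \<circ> chart_inv c) y \<bullet> v)" by blast
  qed
  then have tangent: "v \<bullet> chart_diff c \<psi> p w = 0" for w by (metis inner_commute)
  have "cross3 v (cross3 (chart_diff c \<psi> p (axis 1 1)) (chart_diff c \<psi> p (axis 2 1))) = 0"
    by (simp add: Lagrange tangent)
  moreover have "cross3 (chart_diff c \<psi> p (axis 1 1)) (chart_diff c \<psi> p (axis 2 1)) = area_density c p *\<^sub>R N p"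
    unfolding area_density_def
    by (rule normal_cross[OF gauss_unit[OF c] gauss_normal[OF c] gauss_normal[OF c]])
  ultimately have "area_density c p *\<^sub>R cross3 v (N p) = 0"
    by (simp add: cross_mult_right)
  then have "cross3 (N p) (cross3 v (N p)) = 0" using area_density_nonzero[OF c] by simp
  then have "v = (N p \<bullet> v) *\<^sub>R N p"
    using gauss_unit[OF c] by (simp add: Lagrange norm_eq_1)
  then have "N p \<bullet> v \<noteq> 0" using v by (metis norm_zero scaleR_zero_left zero_neq_one)
  then show thesis using that p(1) by blast
qed

end

theorem theorem4p1:
  fixes l :: real and v :: "real^3"
  assumes "norm v = 1"
  shows "\<not> (\<exists>(X :: 'a topology) A \<psi> N. closed_surface X A \<and> translating_soliton l v X A \<psi> N)"
proof
  assume "\<exists>(X :: 'a topology) A \<psi> N. closed_surface X A \<and> translating_soliton l v X A \<psi> N"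
  then obtain X :: "'a topology" and A \<psi> N
    where closed: "closed_surface X A" and soliton: "translating_soliton l v X A \<psi> N" by blast
  interpret immersed_surface X A \<psi> N
    using closed soliton unfolding closed_surface_def translating_soliton_def by unfold_locales auto
  have compact: "compact_space X" using closed unfolding closed_surface_def by blast
  have H: "2 * mean_curvature A \<psi> N p = 2 * l + N p \<bullet> v" if "p \<in> topspace X" for p
    using soliton that unfolding translating_soliton_def by blast
  obtain p where p: "p \<in> topspace X" "N p \<bullet> v \<noteq> 0"
    by (rule normal_at_highest_point[OF compact assms])
  note curl = scalar_curl_soliton[OF _ H]
  have "scalar_curl (\<lambda>p. cross3 (N p + l *\<^sub>R \<psi> p) v) p = 0"
    by (rule scalar_curl_nonneg_eq_0[OF compact soliton_field_C1 _ p(1)]) (simp add: curl)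
  then show False using curl[OF p(1) p(1)] p(2) by simp
qed

end
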